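(* (a) The dimension data $(d_\lambda)_{\lambda\in\mathcal{P}(n)}$ of the symmetric group $S_n$ is asymptotically log constant as $n\to\infty$. (b) In the limit as $n\to\infty$, the angle between the vector $(d_\lambda)_{\lambda\in\mathcal{P}(n)}$ and the constant vector $\mathbf{1}=(1,\dots,1)\in\mathbb{R}^{\mathcal{P}(n)}$ is $\pi/2$. In particular, the dimension data is not asymptotically constant.
   Context: $\mathcal{P}(n)$ is the set of integer partitions of $n$, and for $\lambda\in\mathcal{P}(n)$, $d_\lambda$ is the dimension of the irreducible complex representation of $S_n$ associated to $\lambda$. Inner products, norms and angles are the standard Euclidean ones. For a sequence of vectors $a^{(n)}\in\mathbb{R}^{\ell_n}$ with $\ell_n\to\infty$, and $\mathbf{1}=(1,\dots,1)\in\mathbb{R}^{\ell_n}$: $a^{(n)}$ is asymptotically constant if $\frac{(a^{(n)},\mathbf{1})}{\|a^{(n)}\|\,\|\mathbf{1}\|}\to 1$ as $n\to\infty$; it is asymptotically log constant if $\frac{\ln(a^{(n)},\mathbf{1})}{\ln(\|a^{(n)}\|\,\|\mathbf{1}\|)}\to 1$ as $n\to\infty$. *)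

theory Defs
  imports
    "HOL-Analysis.Analysis"
    "HOL-Combinatorics.Permutations"
    "HOL-Library.Poly_Mapping"
begin

section \<open>Integer partitions and Specht modules\<close>

definition partitions :: "nat \<Rightarrow> nat list set" where
  "partitions n = {l. sorted_wrt (\<ge>) l \<and> 0 \<notin> set l \<and> sum_list l = n}"

text \<open>Rows and columns are numbered from \<open>0\<close>; row \<open>i\<close> of the Young diagram has \<open>l ! i\<close> cells.\<close>

definition diagram :: "nat list \<Rightarrow> (nat \<times> nat) set" where
  "diagram l = {(i, j). i < length l \<and> j < l ! i}"

text \<open>A tableau is a numbering of the cells by \<open>1, \<dots>, n\<close> (not necessarily standard).
  Its values outside the diagram are irrelevant: nothing below depends on them.\<close>

definition tableau :: "nat list \<Rightarrow> (nat \<times> nat \<Rightarrow> nat) \<Rightarrow> bool" where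
  "tableau l T \<longleftrightarrow> bij_betw T (diagram l) {1..sum_list l}"

text \<open>The tabloid of \<open>T\<close>, i.e. its class modulo reordering of entries within rows, is encoded
  as the list of the sets of entries of its rows. A permutation \<open>p\<close> acts on tabloids by
  \<open>map ((`) p)\<close>.\<close>

definition tabloid :: "nat list \<Rightarrow> (nat \<times> nat \<Rightarrow> nat) \<Rightarrow> nat set list" where
  "tabloid l T = map (\<lambda>i. {T (i, j) | j. j < l ! i}) [0..<length l]"

definition column_stabilizer ::
    "nat list \<Rightarrow> (nat \<times> nat \<Rightarrow> nat) \<Rightarrow> (nat \<Rightarrow> nat) set" where
  "column_stabilizer l T = {p. p permutes {1..sum_list l} \<and>
     (\<forall>j. p ` {T (i, j) | i. (i, j) \<in> diagram l} = {T (i, j) | i. (i, j) \<in> diagram l})}"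

text \<open>The permutation module \<open>M\<^sup>\<lambda>\<close> consists of formal complex linear combinations of tabloids,
  with the symmetric group permuting the tabloids. The following makes the formal complex linear
  combinations of elements of an arbitrary type into a vector space.\<close>

definition formal_scale :: "complex \<Rightarrow> ('a \<Rightarrow>\<^sub>0 complex) \<Rightarrow> ('a \<Rightarrow>\<^sub>0 complex)" where
  "formal_scale c v = Poly_Mapping.map (\<lambda>x. c * x) v"

lemma lookup_formal_scale [simp]: "Poly_Mapping.lookup (formal_scale c v) t = c * Poly_Mapping.lookup v t"
  by (simp add: formal_scale_def Poly_Mapping.map.rep_eq when_def)

global_interpretation formal: vector_space formal_scale
  by unfold_locales (auto intro!: poly_mapping_eqI simp: lookup_add algebra_simps)

text \<open>The polytabloid \<open>e\<^sub>T\<close> is the signed sum of \<open>p {T}\<close> over the column stabilizer of \<open>T\<close>.\<close>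

definition polytabloid :: "nat list \<Rightarrow> (nat \<times> nat \<Rightarrow> nat) \<Rightarrow> (nat set list \<Rightarrow>\<^sub>0 complex)" where
  "polytabloid l T = (\<Sum>p\<in>column_stabilizer l T.
     Poly_Mapping.single (map ((`) p) (tabloid l T)) (of_int (sign p)))"

text \<open>The Specht module is the irreducible complex representation of the symmetric group
  associated to a partition (the trivial one for the partition with a single part).
  It is stable under the action because \<open>p\<close> maps \<open>e\<^sub>T\<close> to the polytabloid of \<open>p \<circ> T\<close>.\<close>

definition specht_module :: "nat list \<Rightarrow> (nat set list \<Rightarrow>\<^sub>0 complex) set" where
  "specht_module l = formal.span {polytabloid l T | T. tableau l T}"

definition specht_dim :: "nat list \<Rightarrow> nat" where
  "specht_dim l = formal.dim (specht_module l)"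


section \<open>Vectors indexed by finite sets, and sequences of them\<close>

text \<open>A vector of \<open>\<real>\<^sup>I\<close>, with \<open>I\<close> a finite set, is a real function considered on \<open>I\<close> only.
  Its Euclidean norm is \<^term>\<open>L2_set a I\<close>.\<close>

definition inner_on :: "'i set \<Rightarrow> ('i \<Rightarrow> real) \<Rightarrow> ('i \<Rightarrow> real) \<Rightarrow> real" where
  "inner_on I a b = (\<Sum>i\<in>I. a i * b i)"

definition angle_on :: "'i set \<Rightarrow> ('i \<Rightarrow> real) \<Rightarrow> ('i \<Rightarrow> real) \<Rightarrow> real" where
  "angle_on I a b = arccos (inner_on I a b / (L2_set a I * L2_set b I))"

text \<open>The next two notions are meant for sequences of vectors \<open>a n\<close> in \<open>\<real>\<^bsup>I n\<^esup>\<close> with all \<open>I n\<close>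
  finite and \<open>card (I n)\<close> tending to infinity.\<close>

definition asymptotically_constant ::
    "(nat \<Rightarrow> 'i set) \<Rightarrow> (nat \<Rightarrow> 'i \<Rightarrow> real) \<Rightarrow> bool" where
  "asymptotically_constant I a \<longleftrightarrow>
     (\<lambda>n. inner_on (I n) (a n) (\<lambda>_. 1) / (L2_set (a n) (I n) * L2_set (\<lambda>_. 1) (I n)))
       \<longlonglongrightarrow> 1"

definition asymptotically_log_constant ::
    "(nat \<Rightarrow> 'i set) \<Rightarrow> (nat \<Rightarrow> 'i \<Rightarrow> real) \<Rightarrow> bool" where
  "asymptotically_log_constant I a \<longleftrightarrow>
     (\<lambda>n. ln (inner_on (I n) (a n) (\<lambda>_. 1)) / ln (L2_set (a n) (I n) * L2_set (\<lambda>_. 1) (I n)))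
       \<longlonglongrightarrow> 1"

end

theory Submission
  imports Defs "HOL-Real_Asymp.Real_Asymp"
begin

text \<open>Write $d_\lambda$ for the dimensions, $p(n)$ for the number of partitions of $n$ and $t_n$ for the sum
  of the $d_\lambda$ over the partitions of $n$. Everything follows from the two classical identities
  $\sum_\lambda d_\lambda^2 = n!$ and $t_{n+2} = t_{n+1} + (n + 1) t_n$ (so that $t_n$ is the number of
  involutions) and from estimates of the three quantities $n!$, $t_n$ and $p(n)$: the cosine of the
  angle between the two vectors is $t_n / \sqrt{n! \, p(n)}$.

  \<^emph>\<open>Logarithms.\<close> As $\sqrt{n!} \le t_n \le \sqrt{n! \, p(n)}$ by elementary inequalities for norms, and
  $p(n) \le 2^n$, both logarithms are $\frac 12 \ln n! + O(n)$, while $\ln n!$ grows faster than $n$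
  (\<open>log_ratio_tendsto_1\<close>).

  \<^emph>\<open>Angle.\<close> The recurrence gives $t_n = O(\sqrt{n!} \, e^{\sqrt n})$ (\<open>total_paths_le\<close>), so it suffices
  that $p(n)$ grows faster than $e^{2 \sqrt n}$ (\<open>exp_sqrt_over_partitions\<close>). The true growth rate is
  $e^{\pi \sqrt{2 n / 3}}$ with $\pi \sqrt{2 / 3} \approx 2.57$, so there is some room, but simple
  volume estimates only give the exponent $2$. The larger exponent comes from a recurrence for $p$
  that takes into account whether a part is repeated (\<open>partitions_recurrence\<close>).

  \<^emph>\<open>The two identities.\<close> They hold for the numbers $f_\lambda$ of saturated chains from the empty diagram to
  $\lambda$ in Young's lattice, because it is a differential poset (\<open>sum_paths_squared\<close>,
  \<open>total_paths_Suc_Suc\<close>). It remains to see $d_\lambda = f_\lambda$. Standard polytabloids are linearly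
  independent since they have distinct leading terms, whence $d_\lambda \ge f_\lambda$
  (\<open>paths_le_specht_dim\<close>). Conversely, $\sum_\lambda d_\lambda^2 \le n!$ because the group algebra contains
  independent elements that act on the Specht modules like matrix units
  (\<open>sum_specht_dim_squared_le\<close>). As $\sum_\lambda f_\lambda^2 = n!$, equality holds throughout.\<close>

section \<open>Young's lattice\<close>

text \<open>A partition is also given by the weakly decreasing function $g$ of its row lengths, which is
  eventually \<open>0\<close>; the row lengths are easier to modify one cell at a time than the list of the
  positive parts is.\<close>

definition cells :: "(nat \<Rightarrow> nat) \<Rightarrow> (nat \<times> nat) set" where
  "cells g = {(i, j). j < g i}"

definition young :: "nat \<Rightarrow> (nat \<Rightarrow> nat) set" where
  "young n = {g. antimono g \<and> finite (cells g) \<and> card (cells g) = n}"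

definition add_cell :: "(nat \<Rightarrow> nat) \<Rightarrow> nat \<Rightarrow> nat \<Rightarrow> nat" where
  "add_cell g i = g(i := Suc (g i))"

definition del_cell :: "(nat \<Rightarrow> nat) \<Rightarrow> nat \<Rightarrow> nat \<Rightarrow> nat" where
  "del_cell g i = g(i := g i - 1)"

definition addable_rows :: "(nat \<Rightarrow> nat) \<Rightarrow> nat set" where
  "addable_rows g = {i. antimono (add_cell g i)}"

definition removable_rows :: "(nat \<Rightarrow> nat) \<Rightarrow> nat set" where
  "removable_rows g = {i. 0 < g i \<and> antimono (del_cell g i)}"

text \<open>The number of ways to reach \<open>g\<close> from the empty diagram by adding one cell at a time, staying
  inside Young's lattice. This is the number of standard tableaux of shape \<open>g\<close>, and it will
  turn out to be the dimension of the Specht module.\<close>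

primrec paths :: "nat \<Rightarrow> (nat \<Rightarrow> nat) \<Rightarrow> nat" where
  "paths 0 g = 1"
| "paths (Suc n) g = (\<Sum>i\<in>removable_rows g. paths n (del_cell g i))"

lemma antimono_Suc_iff: "antimono (g :: nat \<Rightarrow> nat) \<longleftrightarrow> (\<forall>i. g (Suc i) \<le> g i)"
  by (metis antimonoD antimono_iff_le_Suc)

lemma removable_rows_eq: "antimono g \<Longrightarrow> removable_rows g = {i. g (Suc i) < g i}"
proof (intro set_eqI iffI)
  fix i assume "antimono g" "i \<in> removable_rows g"
  hence "del_cell g i (Suc i) \<le> del_cell g i i" "0 < g i"
    unfolding removable_rows_def antimono_Suc_iff by blast+
  thus "i \<in> {i. g (Suc i) < g i}" by (simp add: del_cell_def)
next
  fix i assume g: "antimono g" and i: "i \<in> {i. g (Suc i) < g i}"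
  have "del_cell g i (Suc k) \<le> del_cell g i k" for k
    using g[unfolded antimono_Suc_iff, rule_format, of k] i
    by (cases "k = i"; cases "Suc k = i") (auto simp: del_cell_def)
  thus "i \<in> removable_rows g" using i unfolding removable_rows_def antimono_Suc_iff by simp
qed

text \<open>One can always add a cell to row \<open>0\<close>; a cell fits at the end of row \<open>k + 1\<close> exactly if row \<open>k\<close> is
  strictly longer, i.e. if row \<open>k\<close> has a removable cell.\<close>

lemma addable_rows_eq:
  assumes g: "antimono g"
  shows "addable_rows g = insert 0 (Suc ` removable_rows g)"
proof -
  have "i \<in> addable_rows g \<longleftrightarrow> i = 0 \<or> (\<exists>k. i = Suc k \<and> g (Suc k) < g k)" for i
  proof
    assume i: "i \<in> addable_rows g"
    show "i = 0 \<or> (\<exists>k. i = Suc k \<and> g (Suc k) < g k)"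
    proof (cases i)
      case (Suc k)
      have "add_cell g i (Suc k) \<le> add_cell g i k"
        using i unfolding addable_rows_def antimono_Suc_iff by blast
      thus ?thesis by (simp add: Suc add_cell_def)
    qed simp
  next
    assume i: "i = 0 \<or> (\<exists>k. i = Suc k \<and> g (Suc k) < g k)"
    have "add_cell g i (Suc k) \<le> add_cell g i k" for k
      using g[unfolded antimono_Suc_iff, rule_format, of k] i
      by (cases "k = i"; cases "Suc k = i") (auto simp: add_cell_def)
    thus "i \<in> addable_rows g" unfolding addable_rows_def antimono_Suc_iff by simp
  qed
  thus ?thesis by (auto simp: removable_rows_eq[OF g] image_iff)
qed

lemma cells_add: "cells (add_cell g i) = insert (i, g i) (cells g)"
  by (auto simp: cells_def add_cell_def split: if_splits)

lemma cells_del: "0 < g i \<Longrightarrow> cells (del_cell g i) = cells g - {(i, g i - 1)}"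
  by (auto simp: cells_def del_cell_def split: if_splits)

lemma add_young: "g \<in> young n \<Longrightarrow> i \<in> addable_rows g \<Longrightarrow> add_cell g i \<in> young (Suc n)"
  by (auto simp: young_def addable_rows_def cells_add) (auto simp: cells_def)

lemma del_young: "g \<in> young (Suc n) \<Longrightarrow> i \<in> removable_rows g \<Longrightarrow> del_cell g i \<in> young n"
  by (auto simp: young_def removable_rows_def cells_del card_Diff_singleton_if) (auto simp: cells_def)

lemma finite_removable_rows: "g \<in> young n \<Longrightarrow> finite (removable_rows g)"
proof -
  assume g: "g \<in> young n"
  have "removable_rows g \<subseteq> fst ` cells g" by (force simp: removable_rows_def cells_def image_iff)
  with g show ?thesis by (auto simp: young_def intro: finite_subset)
qed

lemma finite_addable_rows: "g \<in> young n \<Longrightarrow> finite (addable_rows g)"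
  using finite_removable_rows[of g n] by (auto simp: addable_rows_eq young_def)

text \<open>The relation $DU - UD = 1$ of a differential poset on the diagonal; off the diagonal it is the
  exchange lemma below.\<close>

lemma card_addable_rows: "g \<in> young n \<Longrightarrow> card (addable_rows g) = Suc (card (removable_rows g))"
  using finite_removable_rows[of g n] by (auto simp: addable_rows_eq young_def card_image)

lemma del_add [simp]: "del_cell (add_cell g i) i = g"
  by (auto simp: del_cell_def add_cell_def)

lemma add_del [simp]: "0 < g i \<Longrightarrow> add_cell (del_cell g i) i = g"
  by (auto simp: del_cell_def add_cell_def)

lemma removable_rows_pos: "i \<in> removable_rows g \<Longrightarrow> 0 < g i" by (simp add: removable_rows_def)

lemma removable_row_of_add_cell: "g \<in> young n \<Longrightarrow> i \<in> removable_rows (add_cell g i)"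
  by (auto simp: removable_rows_def young_def) (simp add: add_cell_def)

lemma addable_row_of_del_cell: "g \<in> young n \<Longrightarrow> i \<in> removable_rows g \<Longrightarrow> i \<in> addable_rows (del_cell g i)"
  by (auto simp: removable_rows_def addable_rows_def young_def)

lemma add_del_commute: "i \<noteq> j \<Longrightarrow> del_cell (add_cell g i) j = add_cell (del_cell g j) i"
  by (auto simp: del_cell_def add_cell_def)

lemma antimono_min: "antimono (g :: nat \<Rightarrow> nat) \<Longrightarrow> antimono h \<Longrightarrow> antimono (\<lambda>i. min (g i) (h i))"
  unfolding antimono_Suc_iff by (metis min.mono)

lemma antimono_max: "antimono (g :: nat \<Rightarrow> nat) \<Longrightarrow> antimono h \<Longrightarrow> antimono (\<lambda>i. max (g i) (h i))"
  unfolding antimono_Suc_iff by (metis max.mono)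

text \<open>Adding in row \<open>i\<close> and then removing from row \<open>j\<close> leads from \<open>g\<close> to some \<open>m\<close>. The two
  intermediate diagrams are the union and the intersection of \<open>g\<close> and \<open>m\<close>, hence are diagrams
  as soon as \<open>g\<close> and \<open>m\<close> are.\<close>

lemma addable_removable_exchange:
  assumes "antimono g" "i \<noteq> j"
  shows "i \<in> addable_rows g \<and> j \<in> removable_rows (add_cell g i) \<longleftrightarrow> j \<in> removable_rows g \<and> i \<in> addable_rows (del_cell g j)"
proof -
  let ?m = "add_cell (del_cell g j) i"
  have min: "del_cell g j = (\<lambda>k. min (g k) (?m k))" if "0 < g j"
    using assms(2) by (auto simp: del_cell_def add_cell_def)
  have max: "add_cell g i = (\<lambda>k. max (g k) (?m k))"
    using assms(2) by (auto simp: del_cell_def add_cell_def)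
  have pos: "add_cell g i j = g j" using assms(2) by (simp add: add_cell_def)
  show ?thesis
  proof
    assume "i \<in> addable_rows g \<and> j \<in> removable_rows (add_cell g i)"
    hence "0 < g j" "antimono ?m"
      using assms(2) by (auto simp: removable_rows_def pos add_del_commute)
    with min antimono_min[OF assms(1), of ?m] show "j \<in> removable_rows g \<and> i \<in> addable_rows (del_cell g j)"
      by (simp add: removable_rows_def addable_rows_def)
  next
    assume "j \<in> removable_rows g \<and> i \<in> addable_rows (del_cell g j)"
    hence "0 < g j" "antimono ?m" by (auto simp: removable_rows_def addable_rows_def)
    moreover have "antimono (add_cell g i)"
      unfolding max by (rule antimono_max[OF assms(1)]) fact
    ultimately show "i \<in> addable_rows g \<and> j \<in> removable_rows (add_cell g i)"
      using assms(2) by (simp add: removable_rows_def addable_rows_def pos add_del_commute)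
  qed
qed

lemma young_0_eq: "young 0 = {\<lambda>_. 0}"
proof -
  have "cells g = {} \<longleftrightarrow> g = (\<lambda>_. 0)" for g
    by (auto simp: cells_def fun_eq_iff)
  moreover have c: "cells (\<lambda>_. 0) = {}" by (simp add: cells_def)
  ultimately show ?thesis by (auto simp: young_def antimono_Suc_iff c)
qed

lemma young_0: "g \<in> young 0 \<Longrightarrow> g = (\<lambda>_. 0)"
  by (simp add: young_0_eq)

text \<open>The up operator multiplies path counts by $n + 1$: commute the added cell past the last cell of
  each path by \<open>card_addable_rows\<close> (same cell) and \<open>addable_removable_exchange\<close> (different rows) and use induction.\<close>

lemma sum_paths_add_cell:
  assumes "g \<in> young n"
  shows "(\<Sum>i\<in>addable_rows g. paths (Suc n) (add_cell g i)) = Suc n * paths n g"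
  using assms
proof (induction n arbitrary: g)
  case 0
  have d: "removable_rows g = {}" using young_0[OF 0] by (auto simp: removable_rows_def)
  hence u: "addable_rows g = {0}" using 0 by (simp add: addable_rows_eq young_def)
  have g: "g = (\<lambda>_. 0)" using young_0[OF 0] .
  have "antimono (add_cell g 0)" using add_young[OF 0, of 0] u by (simp add: young_def)
  from removable_rows_eq[OF this] have "removable_rows (add_cell g 0) = {0}" by (auto simp: g add_cell_def)
  thus ?case by (simp add: u)
next
  case (Suc n)
  let ?N = "Suc n"
  note g = Suc.prems
  have ag: "antimono g" using g by (simp add: young_def)
  define F where "F = (\<lambda>i j. paths ?N (add_cell (del_cell g j) i))"
  \<comment> \<open>The ways of adding a cell and then removing another one, and of doing this in the opposite order.\<close>
  define P where "P = (SIGMA i:addable_rows g. removable_rows (add_cell g i) - {i})"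
  define Q where "Q = (SIGMA j:removable_rows g. addable_rows (del_cell g j) - {j})"
  have fu: "finite (addable_rows g)" "finite (removable_rows g)" using finite_addable_rows finite_removable_rows g by auto
  have fd: "finite (removable_rows (add_cell g i))" if "i \<in> addable_rows g" for i
    using that finite_removable_rows add_young g by blast
  have fd': "finite (addable_rows (del_cell g i))" if "i \<in> removable_rows g" for i
    using that finite_addable_rows del_young g by blast
  have PQ: "(i,j) \<in> P \<longleftrightarrow> (j,i) \<in> Q" for i j
    using addable_removable_exchange[OF ag, of i j] by (auto simp: P_def Q_def)
  have "(\<Sum>i\<in>addable_rows g. paths (Suc ?N) (add_cell g i))
      = (\<Sum>i\<in>addable_rows g. paths ?N g + (\<Sum>j\<in>removable_rows (add_cell g i) - {i}. F i j))"
  proof (rule sum.cong)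
    fix i assume i: "i \<in> addable_rows g"
    have "paths (Suc ?N) (add_cell g i) = (\<Sum>j\<in>removable_rows (add_cell g i). paths ?N (del_cell (add_cell g i) j))" by simp
    also have "\<dots> = paths ?N g + (\<Sum>j\<in>removable_rows (add_cell g i) - {i}. paths ?N (del_cell (add_cell g i) j))"
      using sum.remove[OF fd[OF i] removable_row_of_add_cell[OF g], of "\<lambda>j. paths ?N (del_cell (add_cell g i) j)"] by simp
    also have "(\<Sum>j\<in>removable_rows (add_cell g i) - {i}. paths ?N (del_cell (add_cell g i) j)) = (\<Sum>j\<in>removable_rows (add_cell g i) - {i}. F i j)"
      by (rule sum.cong) (auto simp: F_def add_del_commute)
    finally show "paths (Suc ?N) (add_cell g i) = paths ?N g + (\<Sum>j\<in>removable_rows (add_cell g i) - {i}. F i j)" .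
  qed simp
  also have "\<dots> = card (addable_rows g) * paths ?N g + (\<Sum>(i,j)\<in>P. F i j)"
    unfolding P_def using fu fd by (subst sum.Sigma[symmetric]) (auto simp: sum.distrib)
  also have "(\<Sum>(i,j)\<in>P. F i j) = (\<Sum>(j,i)\<in>Q. F i j)"
    by (rule sum.reindex_bij_witness[of _ prod.swap prod.swap]) (auto simp: PQ)
  finally have 1: "(\<Sum>i\<in>addable_rows g. paths (Suc ?N) (add_cell g i)) = card (addable_rows g) * paths ?N g + (\<Sum>(j,i)\<in>Q. F i j)" .
  have "?N * paths ?N g = (\<Sum>j\<in>removable_rows g. ?N * paths n (del_cell g j))"
    by (simp only: paths.simps sum_distrib_left)
  also have "\<dots> = (\<Sum>j\<in>removable_rows g. \<Sum>i\<in>addable_rows (del_cell g j). F i j)"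
    by (rule sum.cong) (use Suc.IH del_young[OF g] in \<open>auto simp: F_def\<close>)
  also have "\<dots> = (\<Sum>j\<in>removable_rows g. paths ?N g + (\<Sum>i\<in>addable_rows (del_cell g j) - {j}. F i j))"
  proof (rule sum.cong)
    fix j assume j: "j \<in> removable_rows g"
    show "(\<Sum>i\<in>addable_rows (del_cell g j). F i j) = paths ?N g + (\<Sum>i\<in>addable_rows (del_cell g j) - {j}. F i j)"
      using sum.remove[OF fd'[OF j] addable_row_of_del_cell[OF g j], of "\<lambda>i. F i j"] removable_rows_pos[OF j]
      by (simp add: F_def del: paths.simps)
  qed simp
  also have "\<dots> = card (removable_rows g) * paths ?N g + (\<Sum>(j,i)\<in>Q. F i j)"
    unfolding Q_def using fu fd' by (subst sum.Sigma[symmetric]) (auto simp: sum.distrib)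
  finally show ?case using 1 card_addable_rows[OF g] by simp
qed

lemma finite_young: "finite (young n)"
proof -
  have "young n \<subseteq> {g. \<forall>i. (i < n \<longrightarrow> g i \<in> {..n}) \<and> (i \<notin> {..<n} \<longrightarrow> g i = 0)}"
  proof
    fix g assume g: "g \<in> young n"
    have mono: "g j \<le> g i" if "i \<le> j" for i j using g that by (auto simp: young_def dest: antimonoD)
    have fc: "finite (cells g)" "card (cells g) = n" using g by (auto simp: young_def)
    have "g i \<le> n" for i
    proof -
      have "Pair i ` {..<g i} \<subseteq> cells g" by (auto simp: cells_def)
      from card_mono[OF fc(1) this] fc(2) show ?thesis by (simp add: card_image inj_on_def)
    qed
    moreover have "g i = 0" if "n \<le> i" for i
    proof (rule ccontr)
      assume "g i \<noteq> 0"
      hence "(\<lambda>k. (k, 0)) ` {..i} \<subseteq> cells g" using mono by (force simp: cells_def)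
      from card_mono[OF fc(1) this] fc(2) that show False by (simp add: card_image inj_on_def)
    qed
    ultimately show "g \<in> {g. \<forall>i. (i < n \<longrightarrow> g i \<in> {..n}) \<and> (i \<notin> {..<n} \<longrightarrow> g i = 0)}" by auto
  qed
  moreover have "finite {g. \<forall>i. (i \<in> {..<n} \<longrightarrow> g i \<in> {..n}) \<and> (i \<notin> {..<n} \<longrightarrow> g i = (0::nat))}"
    by (rule finite_set_of_finite_funs) auto
  ultimately show ?thesis by (simp add: finite_subset)
qed

text \<open>Double counting of the pairs of a diagram and one of its removable cells.\<close>

lemma sum_young_Suc:
  fixes F :: "(nat \<Rightarrow> nat) \<Rightarrow> (nat \<Rightarrow> nat) \<Rightarrow> nat"
  shows "(\<Sum>g\<in>young (Suc n). \<Sum>j\<in>removable_rows g. F g (del_cell g j)) = (\<Sum>h\<in>young n. \<Sum>i\<in>addable_rows h. F (add_cell h i) h)"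
proof -
  have "(\<Sum>g\<in>young (Suc n). \<Sum>j\<in>removable_rows g. F g (del_cell g j)) = (\<Sum>(g,j)\<in>(SIGMA g:young (Suc n). removable_rows g). F g (del_cell g j))"
    using finite_young finite_removable_rows by (subst sum.Sigma) auto
  also have "\<dots> = (\<Sum>(h,i)\<in>(SIGMA h:young n. addable_rows h). F (add_cell h i) h)"
    by (rule sum.reindex_bij_witness[of _ "\<lambda>(h,i). (add_cell h i, i)" "\<lambda>(g,j). (del_cell g j, j)"])
      (auto simp: removable_rows_pos del_young add_young removable_row_of_add_cell intro: addable_row_of_del_cell)
  also have "\<dots> = (\<Sum>h\<in>young n. \<Sum>i\<in>addable_rows h. F (add_cell h i) h)"
    using finite_young finite_addable_rows by (subst sum.Sigma) auto
  finally show ?thesis .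
qed

text \<open>The down operator is adjoint to the up operator, so the sum of squares gains the factor $n + 1$
  in the step from $n$ to $n + 1$.\<close>

lemma sum_paths_squared: "(\<Sum>g\<in>young n. (paths n g)\<^sup>2) = fact n"
proof (induction n)
  case 0
  show ?case by (simp add: young_0_eq)
next
  case (Suc n)
  have "(\<Sum>g\<in>young (Suc n). (paths (Suc n) g)\<^sup>2) = (\<Sum>g\<in>young (Suc n). \<Sum>j\<in>removable_rows g. paths (Suc n) g * paths n (del_cell g j))"
    by (simp add: power2_eq_square sum_distrib_left)
  also have "\<dots> = (\<Sum>h\<in>young n. \<Sum>i\<in>addable_rows h. paths (Suc n) (add_cell h i) * paths n h)"
    by (rule sum_young_Suc)
  also have "\<dots> = (\<Sum>h\<in>young n. Suc n * (paths n h)\<^sup>2)"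
  proof (rule sum.cong)
    fix h assume h: "h \<in> young n"
    show "(\<Sum>i\<in>addable_rows h. paths (Suc n) (add_cell h i) * paths n h) = Suc n * (paths n h)\<^sup>2"
      unfolding sum_distrib_right[symmetric] sum_paths_add_cell[OF h] by (simp add: power2_eq_square algebra_simps)
  qed simp
  also have "\<dots> = fact (Suc n)" using Suc by (simp only: sum_distrib_left[symmetric] fact_Suc of_nat_id)
  finally show ?case .
qed

definition total_paths :: "nat \<Rightarrow> nat" where
  "total_paths n = (\<Sum>g\<in>young n. paths n g)"

lemma total_paths_Suc_eq: "total_paths (Suc n) = (\<Sum>h\<in>young n. card (addable_rows h) * paths n h)"
  using sum_young_Suc[of "\<lambda>g h. paths n h"] by (simp add: total_paths_def)

text \<open>The recurrence of the number of involutions of $n$ points: by \<open>card_addable_rows\<close> every diagram has one addable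
  row more than it has removable rows, and the surplus gives the first summand.\<close>

lemma total_paths_Suc_Suc: "total_paths (Suc (Suc n)) = total_paths (Suc n) + Suc n * total_paths n"
proof -
  have "total_paths (Suc (Suc n)) = (\<Sum>h\<in>young (Suc n). paths (Suc n) h + (\<Sum>j\<in>removable_rows h. paths (Suc n) h))"
    unfolding total_paths_Suc_eq by (rule sum.cong) (auto simp: card_addable_rows)
  also have "\<dots> = total_paths (Suc n) + (\<Sum>h\<in>young (Suc n). \<Sum>j\<in>removable_rows h. paths (Suc n) h)"
    by (simp add: sum.distrib total_paths_def)
  also have "(\<Sum>h\<in>young (Suc n). \<Sum>j\<in>removable_rows h. paths (Suc n) h) = (\<Sum>h\<in>young n. \<Sum>i\<in>addable_rows h. paths (Suc n) (add_cell h i))"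
    by (rule sum_young_Suc)
  also have "\<dots> = (\<Sum>h\<in>young n. Suc n * paths n h)"
    by (rule sum.cong) (auto simp: sum_paths_add_cell simp del: paths.simps)
  also have "\<dots> = Suc n * total_paths n" by (simp only: total_paths_def sum_distrib_left)
  finally show ?thesis .
qed

section \<open>Partitions as lists\<close>

definition nth_part :: "nat list \<Rightarrow> nat \<Rightarrow> nat" where
  "nth_part l i = (if i < length l then l ! i else 0)"

lemma diagram_eq_cells: "diagram l = cells (nth_part l)"
  by (auto simp: diagram_def cells_def nth_part_def split: if_splits)

lemma diagram_Sigma: "diagram l = Sigma {..<length l} (\<lambda>i. {..<l ! i})"
  by (auto simp: diagram_def)

lemma finite_diagram: "finite (diagram l)"
  by (simp add: diagram_Sigma)

lemma card_diagram: "card (diagram l) = sum_list l"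
  by (simp add: diagram_Sigma sum_list_sum_nth atLeast0LessThan)

lemma antimono_nth_part: "l \<in> partitions n \<Longrightarrow> antimono (nth_part l)"
  unfolding antimono_Suc_iff by (auto simp: partitions_def nth_part_def sorted_wrt_iff_nth_less)

lemma nth_part_in_young: "l \<in> partitions n \<Longrightarrow> nth_part l \<in> young n"
  using antimono_nth_part[of l n] card_diagram[of l] finite_diagram[of l]
  by (simp add: young_def diagram_eq_cells partitions_def)

lemma inj_on_nth_part: "inj_on nth_part (partitions n)"
proof (rule inj_onI)
  fix l m assume l: "l \<in> partitions n" and m: "m \<in> partitions n" and eq: "nth_part l = nth_part m"
  have pos: "i < length l \<longleftrightarrow> nth_part l i \<noteq> 0" if "l \<in> partitions n" for l i
    using that nth_mem[of i l] by (auto simp: nth_part_def partitions_def simp del: nth_mem intro!: gr0I)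
  have iff: "i < length l \<longleftrightarrow> i < length m" for i using pos[OF l] pos[OF m] eq by simp
  have "length l = length m" using iff[of "length l"] iff[of "length m"] by simp
  moreover have "l ! i = m ! i" if "i < length l" for i
    using fun_cong[OF eq, of i] that iff[of i] by (simp add: nth_part_def)
  ultimately show "l = m" by (intro nth_equalityI)
qed

text \<open>The list of the positive row lengths is recovered by stopping at the first empty row.\<close>

lemma nth_part_surj:
  assumes g: "g \<in> young n"
  shows "\<exists>l\<in>partitions n. nth_part l = g"
proof -
  have ag: "antimono g" and fg: "finite (cells g)" "card (cells g) = n" using g by (auto simp: young_def)
  have "\<exists>i. g i = 0"
  proof (rule ccontr)
    assume "\<nexists>i. g i = 0"
    hence "range (\<lambda>i. (i, 0)) \<subseteq> cells g" by (auto simp: cells_def)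
    hence "finite (range (\<lambda>i::nat. (i, 0::nat)))" using fg(1) finite_subset by blast
    thus False by (simp add: finite_image_iff inj_on_def)
  qed
  then obtain i where i: "g i = 0" by blast
  define k where "k = (LEAST i. g i = 0)"
  have k: "g k = 0" unfolding k_def using i by (rule LeastI)
  have lt: "g i \<noteq> 0" if "i < k" for i using not_less_Least[of i "\<lambda>i. g i = 0"] that by (simp add: k_def)
  define l where "l = map g [0..<k]"
  have pl: "nth_part l = g"
  proof
    fix i show "nth_part l i = g i"
      using antimonoD[OF ag, of k i] k by (cases "i < k") (auto simp: nth_part_def l_def)
  qed
  have "sorted_wrt (\<ge>) l" using ag by (auto simp: l_def sorted_wrt_iff_nth_less antimono_def)
  moreover have "0 \<notin> set l" using lt by (force simp: l_def)
  moreover have "sum_list l = n" using card_diagram[of l] fg by (simp add: diagram_eq_cells pl)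
  ultimately show ?thesis using pl by (auto simp: partitions_def)
qed

lemma bij_betw_nth_part: "bij_betw nth_part (partitions n) (young n)"
  unfolding bij_betw_def using inj_on_nth_part nth_part_in_young nth_part_surj by (auto simp: image_iff) (metis)

lemma finite_partitions: "finite (partitions n)"
  using bij_betw_finite[OF bij_betw_nth_part] finite_young by blast

section \<open>Standard tableaux\<close>

text \<open>The largest entry of a standard tableau sits in a removable cell, and deleting it leaves a
  standard tableau. The value \<open>0\<close> outside the diagram makes each tableau a single function, so that
  they can be counted.\<close>

primrec standard_tableaux :: "nat \<Rightarrow> (nat \<Rightarrow> nat) \<Rightarrow> (nat \<times> nat \<Rightarrow> nat) set" where
  "standard_tableaux 0 g = {\<lambda>_. 0}"
| "standard_tableaux (Suc n) g = (\<Union>i\<in>removable_rows g. (\<lambda>T. T((i, g i - 1) := Suc n)) ` standard_tableaux n (del_cell g i))"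

lemma standard_tableau_bij: "g \<in> young n \<Longrightarrow> T \<in> standard_tableaux n g \<Longrightarrow> bij_betw T (cells g) {1..n}"
proof (induction n arbitrary: g T)
  case 0
  thus ?case by (auto simp: young_def bij_betw_def)
next
  case (Suc n)
  then obtain i T' where i: "i \<in> removable_rows g" and T': "T' \<in> standard_tableaux n (del_cell g i)"
    and T: "T = T'((i, g i - 1) := Suc n)" by auto
  let ?c = "(i, g i - 1)"
  have b: "bij_betw T' (cells g - {?c}) {1..n}"
    using Suc.IH[OF del_young[OF Suc.prems(1) i] T'] removable_rows_pos[OF i] by (simp add: cells_del)
  have c: "?c \<in> cells g" using removable_rows_pos[OF i] by (simp add: cells_def)
  have "bij_betw T (cells g - {?c}) {1..n}"
    using b by (rule bij_betw_cong[THEN iffD1, rotated]) (auto simp: T)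
  moreover have "T ?c \<notin> {1..n}" by (simp add: T)
  ultimately have "bij_betw T (insert ?c (cells g - {?c})) (insert (T ?c) {1..n})"
    by (metis Diff_iff insertI1 notIn_Un_bij_betw3 Un_insert_right sup_bot_right)
  moreover have "insert (T ?c) {1..n} = {1..Suc n}" by (auto simp: T)
  ultimately show ?case using c by (simp add: insert_absorb)
qed

lemma standard_tableau_outside: "g \<in> young n \<Longrightarrow> T \<in> standard_tableaux n g \<Longrightarrow> c \<notin> cells g \<Longrightarrow> T c = 0"
proof (induction n arbitrary: g T)
  case (Suc n)
  then obtain i T' where i: "i \<in> removable_rows g" and T': "T' \<in> standard_tableaux n (del_cell g i)"
    and T: "T = T'((i, g i - 1) := Suc n)" by auto
  have "(i, g i - 1) \<in> cells g" using removable_rows_pos[OF i] by (simp add: cells_def)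
  thus ?case using Suc.IH[OF del_young[OF Suc.prems(1) i] T'] Suc.prems(3) removable_rows_pos[OF i]
    by (auto simp: T cells_del)
qed auto

lemma standard_tableau_le:
  assumes "g \<in> young n" "T \<in> standard_tableaux n g"
  shows "T c \<le> n"
  using standard_tableau_outside[OF assms, of c] bij_betwE[OF standard_tableau_bij[OF assms]] by (cases "c \<in> cells g") auto

lemma standard_tableau_increasing:
  assumes "g \<in> young n" "T \<in> standard_tableaux n g"
  shows "i < i' \<Longrightarrow> (i', j) \<in> cells g \<Longrightarrow> T (i, j) < T (i', j)"
    and "j < j' \<Longrightarrow> (i, j') \<in> cells g \<Longrightarrow> T (i, j) < T (i, j')"
proof -
  have "(i < i' \<longrightarrow> (i', j) \<in> cells g \<longrightarrow> T (i, j) < T (i', j)) \<and>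
        (j < j' \<longrightarrow> (i, j') \<in> cells g \<longrightarrow> T (i, j) < T (i, j'))"
    using assms
  proof (induction n arbitrary: g T)
    case 0
    thus ?case by (simp add: young_0_eq cells_def)
  next
    case (Suc n)
    then obtain k T' where k: "k \<in> removable_rows g" and T': "T' \<in> standard_tableaux n (del_cell g k)"
      and T: "T = T'((k, g k - 1) := Suc n)" by auto
    let ?c = "(k, g k - 1)" and ?g = "del_cell g k"
    note y = del_young[OF Suc.prems(1) k]
    note IH = Suc.IH[OF y T']
    have le: "T' d < Suc n" for d using standard_tableau_le[OF y T', of d] by simp
    have ag: "antimono g" using Suc.prems(1) by (simp add: young_def)
    have gk: "g (Suc k) < g k" using k removable_rows_eq[OF ag] by simp
    have cg: "cells ?g = cells g - {?c}" using removable_rows_pos[OF k] by (simp add: cells_del)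
    show ?case
    proof (intro conjI impI)
      assume ii: "i < i'" "(i', j) \<in> cells g"
      show "T (i, j) < T (i', j)"
      proof (cases "(i', j) = ?c")
        case True
        hence "(i, j) \<noteq> ?c" using ii by auto
        hence 1: "T (i, j) = T' (i, j)" unfolding T by (rule fun_upd_other)
        have 2: "T ?c = Suc n" unfolding T by (rule fun_upd_same)
        have "T (i, j) < T ?c" unfolding 1 2 by (rule le)
        thus ?thesis unfolding True .
      next
        case False
        have "(i, j) \<noteq> ?c"
        proof
          assume "(i, j) = ?c"
          moreover have "g i' \<le> g (Suc i)" using antimonoD[OF ag, of "Suc i" i'] ii by simp
          ultimately show False using ii gk by (auto simp: cells_def)
        qed
        hence "T (i, j) = T' (i, j)" "T (i', j) = T' (i', j)" unfolding T using False by (simp_all only: fun_upd_other simp_thms)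
        moreover have "(i', j) \<in> cells ?g" using False ii cg by blast
        ultimately show ?thesis using IH ii(1) by (simp only: simp_thms)
      qed
    next
      assume jj: "j < j'" "(i, j') \<in> cells g"
      show "T (i, j) < T (i, j')"
      proof (cases "(i, j') = ?c")
        case True
        hence "(i, j) \<noteq> ?c" using jj by auto
        hence 1: "T (i, j) = T' (i, j)" unfolding T by (rule fun_upd_other)
        have 2: "T ?c = Suc n" unfolding T by (rule fun_upd_same)
        have "T (i, j) < T ?c" unfolding 1 2 by (rule le)
        thus ?thesis unfolding True .
      next
        case False
        have "(i, j) \<noteq> ?c" using jj by (auto simp: cells_def)
        hence "T (i, j) = T' (i, j)" "T (i, j') = T' (i, j')" unfolding T using False by (simp_all only: fun_upd_other simp_thms)
        moreover have "(i, j') \<in> cells ?g" using False jj cg by blast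
        ultimately show ?thesis using IH jj(1) by (simp only: simp_thms)
      qed
    qed
  qed
  thus "i < i' \<Longrightarrow> (i', j) \<in> cells g \<Longrightarrow> T (i, j) < T (i', j)"
    and "j < j' \<Longrightarrow> (i, j') \<in> cells g \<Longrightarrow> T (i, j) < T (i, j')" by auto
qed

lemma card_standard_tableaux: "g \<in> young n \<Longrightarrow> finite (standard_tableaux n g) \<and> card (standard_tableaux n g) = paths n g"
proof (induction n arbitrary: g)
  case (Suc n)
  let ?A = "\<lambda>i. (\<lambda>T. T((i, g i - 1) := Suc n)) ` standard_tableaux n (del_cell g i)"
  have y: "del_cell g i \<in> young n" if "i \<in> removable_rows g" for i using del_young Suc.prems that by blast
  have le: "T c \<le> n" if "i \<in> removable_rows g" "T \<in> standard_tableaux n (del_cell g i)" for i T c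
    using standard_tableau_le y that by blast
  have inj: "inj_on (\<lambda>T. T((i, g i - 1) := Suc n)) (standard_tableaux n (del_cell g i))" if i: "i \<in> removable_rows g" for i
  proof (rule inj_onI)
    fix T1 T2 assume T: "T1 \<in> standard_tableaux n (del_cell g i)" "T2 \<in> standard_tableaux n (del_cell g i)"
      and eq: "T1((i, g i - 1) := Suc n) = T2((i, g i - 1) := Suc n)"
    have "(i, g i - 1) \<notin> cells (del_cell g i)" using removable_rows_pos[OF i] by (simp add: cells_del)
    hence "T1 (i, g i - 1) = T2 (i, g i - 1)"
      using standard_tableau_outside[OF y[OF i] T(1)] standard_tableau_outside[OF y[OF i] T(2)] by metis
    thus "T1 = T2" using eq by (metis fun_upd_triv fun_upd_upd)
  qed
  have disj: "?A i \<inter> ?A i' = {}" if "i \<in> removable_rows g" "i' \<in> removable_rows g" "i \<noteq> i'" for i i'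
  proof (rule ccontr)
    assume "?A i \<inter> ?A i' \<noteq> {}"
    then obtain T T' where T: "T \<in> standard_tableaux n (del_cell g i)" "T' \<in> standard_tableaux n (del_cell g i')"
      "T((i, g i - 1) := Suc n) = T'((i', g i' - 1) := Suc n)" by auto
    from fun_cong[OF T(3), of "(i, g i - 1)"] that(3) have "T' (i, g i - 1) = Suc n" by simp
    with le[OF that(2) T(2), of "(i, g i - 1)"] show False by simp
  qed
  have "card (\<Union>i\<in>removable_rows g. ?A i) = (\<Sum>i\<in>removable_rows g. card (?A i))"
    using finite_removable_rows[OF Suc.prems] Suc.IH y disj by (intro card_UN_disjoint) auto
  also have "\<dots> = paths (Suc n) g" using Suc.IH y inj by (simp add: card_image)
  finally show ?case using finite_removable_rows[OF Suc.prems] Suc.IH y by simp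
qed simp

section \<open>Tabloids and column stabilizers\<close>

text \<open>The position of the entry \<open>a\<close> in \<open>T\<close>, meaningful for tableaux \<open>T\<close> and entries
  $1 \le a \le n$ only. A tabloid remembers exactly the rows of the entries.\<close>

definition row_of :: "nat list \<Rightarrow> (nat \<times> nat \<Rightarrow> nat) \<Rightarrow> nat \<Rightarrow> nat" where
  "row_of l T a = fst (inv_into (diagram l) T a)"

definition col_of :: "nat list \<Rightarrow> (nat \<times> nat \<Rightarrow> nat) \<Rightarrow> nat \<Rightarrow> nat" where
  "col_of l T a = snd (inv_into (diagram l) T a)"

lemma row_col_tableau:
  assumes "tableau l T" "c \<in> diagram l"
  shows "row_of l T (T c) = fst c" "col_of l T (T c) = snd c"
  using assms by (auto simp: row_of_def col_of_def tableau_def bij_betw_def)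

lemma tableau_cell:
  assumes "tableau l T" "a \<in> {1..sum_list l}"
  obtains c where "c \<in> diagram l" "a = T c" "row_of l T a = fst c" "col_of l T a = snd c"
  using assms row_col_tableau[OF assms(1)] unfolding tableau_def bij_betw_def by (metis imageE)

lemma row_col_inj:
  assumes "tableau l T" "a \<in> {1..sum_list l}" "b \<in> {1..sum_list l}"
    "row_of l T a = row_of l T b" "col_of l T a = col_of l T b"
  shows "a = b"
  using tableau_cell[OF assms(1,2)] tableau_cell[OF assms(1,3)] assms(4,5) by (metis prod_eq_iff)

lemma tableau_mem: "tableau l T \<Longrightarrow> c \<in> diagram l \<Longrightarrow> T c \<in> {1..sum_list l}"
  unfolding tableau_def by (rule bij_betwE[rule_format])

lemma tabloid_eq:
  assumes "tableau l T"
  shows "tabloid l T = map (\<lambda>i. {a \<in> {1..sum_list l}. row_of l T a = i}) [0..<length l]"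
proof -
  have "{T (i, j) | j. j < l ! i} = {a \<in> {1..sum_list l}. row_of l T a = i}" if "i < length l" for i
  proof (intro set_eqI iffI)
    fix a assume "a \<in> {T (i, j) | j. j < l ! i}"
    then obtain j where j: "j < l ! i" "a = T (i, j)" by blast
    hence "(i, j) \<in> diagram l" using that by (simp add: diagram_def)
    thus "a \<in> {a \<in> {1..sum_list l}. row_of l T a = i}"
      using j row_col_tableau[OF assms] tableau_mem[OF assms] by force
  next
    fix a assume "a \<in> {a \<in> {1..sum_list l}. row_of l T a = i}"
    then obtain c where "c \<in> diagram l" "a = T c" "fst c = i" by (metis (lifting) tableau_cell[OF assms] mem_Collect_eq)
    thus "a \<in> {T (i, j) | j. j < l ! i}" by (cases c) (auto simp: diagram_def)
  qed
  thus ?thesis by (simp add: tabloid_def)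
qed

lemma row_less: "tableau l T \<Longrightarrow> a \<in> {1..sum_list l} \<Longrightarrow> row_of l T a < length l"
  by (erule (1) tableau_cell) (auto simp: diagram_def)

lemma tabloid_eq_iff:
  assumes T: "tableau l T" and S: "tableau l S"
  shows "tabloid l T = tabloid l S \<longleftrightarrow> (\<forall>a\<in>{1..sum_list l}. row_of l T a = row_of l S a)"
proof
  assume eq: "tabloid l T = tabloid l S"
  show "\<forall>a\<in>{1..sum_list l}. row_of l T a = row_of l S a"
  proof
    fix a assume a: "a \<in> {1..sum_list l}"
    let ?i = "row_of l T a"
    have "tabloid l T ! ?i = tabloid l S ! ?i" using eq by simp
    hence "{b \<in> {1..sum_list l}. row_of l T b = ?i} = {b \<in> {1..sum_list l}. row_of l S b = ?i}"
      using row_less[OF T a] unfolding tabloid_eq[OF T] tabloid_eq[OF S] by simp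
    from this[THEN eqset_imp_iff, of a] show "row_of l T a = row_of l S a" using a by simp
  qed
next
  assume "\<forall>a\<in>{1..sum_list l}. row_of l T a = row_of l S a"
  thus "tabloid l T = tabloid l S" unfolding tabloid_eq[OF T] tabloid_eq[OF S] by auto
qed

lemma tableau_comp:
  assumes "tableau l T" "p permutes {1..sum_list l}"
  shows "tableau l (p \<circ> T)"
  using assms permutes_imp_bij unfolding tableau_def by (blast intro: bij_betw_trans)

lemma row_col_comp:
  assumes "tableau l T" "p permutes {1..sum_list l}" "a \<in> {1..sum_list l}"
  shows "row_of l (p \<circ> T) (p a) = row_of l T a" "col_of l (p \<circ> T) (p a) = col_of l T a"
proof -
  obtain c where c: "c \<in> diagram l" "a = T c" "row_of l T a = fst c" "col_of l T a = snd c"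
    using tableau_cell[OF assms(1,3)] .
  show "row_of l (p \<circ> T) (p a) = row_of l T a" "col_of l (p \<circ> T) (p a) = col_of l T a"
    using row_col_tableau[OF tableau_comp[OF assms(1,2)] c(1)] c by auto
qed

lemma act_tabloid: "map ((`) p) (tabloid l T) = tabloid l (p \<circ> T)"
  by (auto simp: tabloid_def)

lemma act_act: "map ((`) p) (map ((`) q) s) = map ((`) (p \<circ> q)) s"
  by (simp add: image_comp)

lemma tabloid_cong: "(\<And>c. c \<in> diagram l \<Longrightarrow> T c = S c) \<Longrightarrow> tabloid l T = tabloid l S"
  unfolding tabloid_def diagram_def by (intro map_cong refl) (auto intro!: Collect_cong, metis+)

lemma column_stabilizer_cong:
  assumes "\<And>c. c \<in> diagram l \<Longrightarrow> T c = S c"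
  shows "column_stabilizer l T = column_stabilizer l S"
proof -
  have "{T (i, j) | i. (i, j) \<in> diagram l} = {S (i, j) | i. (i, j) \<in> diagram l}" for j
    using assms by (metis (no_types, opaque_lifting))
  thus ?thesis by (simp add: column_stabilizer_def)
qed

lemma polytabloid_cong:
  assumes "\<And>c. c \<in> diagram l \<Longrightarrow> T c = S c"
  shows "polytabloid l T = polytabloid l S"
  using tabloid_cong[OF assms] column_stabilizer_cong[OF assms] by (simp add: polytabloid_def)

lemma column_set:
  assumes "tableau l T"
  shows "{T (i, j) | i. (i, j) \<in> diagram l} = {a \<in> {1..sum_list l}. col_of l T a = j}"
proof (intro set_eqI iffI)
  fix a assume "a \<in> {T (i, j) | i. (i, j) \<in> diagram l}"
  thus "a \<in> {a \<in> {1..sum_list l}. col_of l T a = j}"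
    using row_col_tableau[OF assms] tableau_mem[OF assms] by force
next
  fix a assume "a \<in> {a \<in> {1..sum_list l}. col_of l T a = j}"
  then obtain c where "c \<in> diagram l" "a = T c" "snd c = j" by (metis (lifting) tableau_cell[OF assms] mem_Collect_eq)
  thus "a \<in> {T (i, j) | i. (i, j) \<in> diagram l}" by (cases c) auto
qed

lemma column_stabilizer_iff:
  assumes T: "tableau l T"
  shows "p \<in> column_stabilizer l T \<longleftrightarrow>
    p permutes {1..sum_list l} \<and> (\<forall>a\<in>{1..sum_list l}. col_of l T (p a) = col_of l T a)"
proof -
  let ?C = "\<lambda>j. {a \<in> {1..sum_list l}. col_of l T a = j}"
  have "(\<forall>j. p ` ?C j = ?C j) \<longleftrightarrow> (\<forall>a\<in>{1..sum_list l}. col_of l T (p a) = col_of l T a)"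
    if p: "p permutes {1..sum_list l}"
  proof
    assume "\<forall>j. p ` ?C j = ?C j"
    thus "\<forall>a\<in>{1..sum_list l}. col_of l T (p a) = col_of l T a" by blast
  next
    assume r: "\<forall>a\<in>{1..sum_list l}. col_of l T (p a) = col_of l T a"
    show "\<forall>j. p ` ?C j = ?C j"
    proof
      fix j
      have "p ` ?C j \<subseteq> ?C j" using r permutes_in_image[OF p] by auto
      moreover have "inj_on p (?C j)" using permutes_inj[OF p] by (rule inj_on_subset) simp
      ultimately show "p ` ?C j = ?C j" by (intro endo_inj_surj) auto
    qed
  qed
  thus ?thesis unfolding column_stabilizer_def column_set[OF T] by auto
qed

lemma finite_column_stabilizer: "finite (column_stabilizer l T)"
  by (rule finite_subset[OF _ finite_permutations[of "{1..sum_list l}"]]) (auto simp: column_stabilizer_def)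

lemma column_stabilizer_comp:
  assumes T: "tableau l T" and "p \<in> column_stabilizer l T" "q \<in> column_stabilizer l T"
  shows "p \<circ> q \<in> column_stabilizer l T"
  using assms permutes_in_image[of q "{1..sum_list l}"]
  by (auto simp: column_stabilizer_iff[OF T] permutes_compose)

lemma column_stabilizer_inv:
  assumes T: "tableau l T" and p: "p \<in> column_stabilizer l T"
  shows "inv p \<in> column_stabilizer l T"
proof -
  have P: "p permutes {1..sum_list l}" and c: "\<And>a. a \<in> {1..sum_list l} \<Longrightarrow> col_of l T (p a) = col_of l T a"
    using p column_stabilizer_iff[OF T] by auto
  note iP = permutes_inv[OF P]
  have "col_of l T (inv p a) = col_of l T a" if "a \<in> {1..sum_list l}" for a
    using c[of "inv p a"] that permutes_in_image[OF iP] permutes_inverses(1)[OF P] by simp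
  thus ?thesis using iP column_stabilizer_iff[OF T] by blast
qed

lemma column_stabilizer_permutes: "p \<in> column_stabilizer l T \<Longrightarrow> p permutes {1..sum_list l}"
  by (simp add: column_stabilizer_def)

lemma ball_permutes: "g permutes N \<Longrightarrow> (\<forall>a\<in>N. P a) \<longleftrightarrow> (\<forall>b\<in>N. P (g b))"
  by (metis permutes_in_image permutes_surj surjD)

lemma column_stabilizer_conj:
  assumes T: "tableau l T" and g: "g permutes {1..sum_list l}"
  shows "p \<in> column_stabilizer l T \<longleftrightarrow> g \<circ> p \<circ> inv g \<in> column_stabilizer l (g \<circ> T)"
proof -
  let ?N = "{1..sum_list l}"
  note gT = tableau_comp[OF T g] and ig = permutes_inv[OF g]
  have inv: "inv g (g x) = x" "g (inv g x) = x" for x using permutes_inverses[OF g] by auto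
  have "p permutes ?N \<longleftrightarrow> g \<circ> p \<circ> inv g permutes ?N"
  proof
    assume "g \<circ> p \<circ> inv g permutes ?N"
    from permutes_compose[OF permutes_compose[OF g this] ig] show "p permutes ?N"
      by (simp add: comp_def inv)
  next
    assume p: "p permutes ?N"
    show "g \<circ> p \<circ> inv g permutes ?N" by (rule permutes_compose[OF ig permutes_compose[OF p g]])
  qed
  moreover have "(\<forall>a\<in>?N. col_of l T (p a) = col_of l T a) \<longleftrightarrow>
      (\<forall>a\<in>?N. col_of l (g \<circ> T) ((g \<circ> p \<circ> inv g) a) = col_of l (g \<circ> T) a)" if p: "p permutes ?N"
  proof -
    have "(\<forall>a\<in>?N. col_of l (g \<circ> T) ((g \<circ> p \<circ> inv g) a) = col_of l (g \<circ> T) a) \<longleftrightarrow>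
      (\<forall>b\<in>?N. col_of l (g \<circ> T) (g (p b)) = col_of l (g \<circ> T) (g b))"
      by (subst ball_permutes[OF g]) (simp add: inv)
    also have "\<dots> \<longleftrightarrow> (\<forall>b\<in>?N. col_of l T (p b) = col_of l T b)"
      using row_col_comp(2)[OF T g] permutes_in_image[OF p] by simp
    finally show ?thesis ..
  qed
  ultimately show ?thesis unfolding column_stabilizer_iff[OF T] column_stabilizer_iff[OF gT] by blast
qed

lemma lookup_polytabloid:
  "Poly_Mapping.lookup (polytabloid l T) u =
    (\<Sum>p\<in>column_stabilizer l T. if map ((`) p) (tabloid l T) = u then of_int (sign p) else 0)"
  by (simp add: polytabloid_def lookup_sum lookup_single when_def)

text \<open>A permutation that preserves the rows and the columns of \<open>T\<close> fixes every cell. Therefore no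
  cancellation happens in the sum that defines a polytabloid.\<close>

lemma column_stabilizer_tabloid_inj:
  assumes T: "tableau l T" and p: "p \<in> column_stabilizer l T" and q: "q \<in> column_stabilizer l T"
    and eq: "map ((`) p) (tabloid l T) = map ((`) q) (tabloid l T)"
  shows "p = q"
proof -
  let ?N = "{1..sum_list l}"
  have P: "p permutes ?N" and Q: "q permutes ?N"
    and cp: "\<And>a. a \<in> ?N \<Longrightarrow> col_of l T (p a) = col_of l T a" and cq: "\<And>a. a \<in> ?N \<Longrightarrow> col_of l T (q a) = col_of l T a"
    using p q column_stabilizer_iff[OF T] by auto
  have r: "row_of l (p \<circ> T) a = row_of l (q \<circ> T) a" if "a \<in> ?N" for a
    using eq that unfolding act_tabloid tabloid_eq_iff[OF tableau_comp[OF T P] tableau_comp[OF T Q]] by blast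
  have "p b = q b" if b: "b \<in> ?N" for b
  proof -
    let ?b = "inv q (p b)"
    have pb: "p b \<in> ?N" using b permutes_in_image[OF P] by simp
    have b': "?b \<in> ?N" using pb permutes_in_image[OF permutes_inv[OF Q]] by simp
    have qb: "q ?b = p b" using permutes_inverses(1)[OF Q] .
    have "row_of l T b = row_of l T ?b" using r[OF pb] row_col_comp(1)[OF T P b] row_col_comp(1)[OF T Q b'] qb by simp
    moreover have "col_of l T b = col_of l T ?b" using cp[OF b] cq[OF b'] qb by simp
    ultimately have "b = ?b" using row_col_inj[OF T b b'] by blast
    thus ?thesis using qb by simp
  qed
  moreover have "p b = q b" if "b \<notin> ?N" for b
    using that permutes_not_in[OF P] permutes_not_in[OF Q] by simp
  ultimately show ?thesis by blast
qed

section \<open>The action of signed column sums on tabloids\<close>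

text \<open>The coefficient of the tabloid \<open>u\<close> in $g \kappa_T s$, where $\kappa_T$ is the signed sum over the
  column stabilizer of \<open>T\<close>.\<close>

definition signed_orbit_sum ::
    "nat list \<Rightarrow> (nat \<times> nat \<Rightarrow> nat) \<Rightarrow> (nat \<Rightarrow> nat) \<Rightarrow> nat set list \<Rightarrow> nat set list \<Rightarrow> complex" where
  "signed_orbit_sum l T g s u =
     (\<Sum>p\<in>column_stabilizer l T. if map ((`) (g \<circ> p)) s = u then of_int (sign p) else 0)"

lemma sign_comp_column_stabilizer:
  assumes "p \<in> column_stabilizer l T" "q \<in> column_stabilizer l T"
  shows "sign (p \<circ> q) = sign p * sign q"
  using assms by (intro sign_compose) (auto simp: permutation_permutes dest: column_stabilizer_permutes)

text \<open>If two entries of a column of \<open>T\<close> share a row of \<open>S\<close>, their transposition fixes the tabloid of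
  \<open>S\<close> and lies in the column stabilizer. Composing with it therefore is a sign reversing
  involution of the summands.\<close>

lemma signed_orbit_sum_collision:
  assumes T: "tableau l T" and S: "tableau m S" and lm: "sum_list l = sum_list m"
    and ab: "a \<in> {1..sum_list l}" "b \<in> {1..sum_list l}" "a \<noteq> b"
    and c: "col_of l T a = col_of l T b" and r: "row_of m S a = row_of m S b"
  shows "signed_orbit_sum l T g (tabloid m S) u = 0"
proof -
  let ?N = "{1..sum_list l}"
  define t where "t = Transposition.transpose a b"
  have tp: "t permutes ?N" unfolding t_def using ab by (intro permutes_swap_id) auto
  have tt: "t \<circ> t = id" by (simp add: t_def)
  have ts: "map ((`) t) (tabloid m S) = tabloid m S"
  proof -
    have tm: "t permutes {1..sum_list m}" using tp lm by simp
    have "row_of m (t \<circ> S) x = row_of m S x" if "x \<in> {1..sum_list m}" for x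
    proof -
      have tx: "t x \<in> {1..sum_list m}" using that permutes_in_image[OF tm] by simp
      have "t (t x) = x" using tt by (metis comp_apply id_apply)
      hence "row_of m (t \<circ> S) x = row_of m S (t x)" using row_col_comp(1)[OF S tm tx] by simp
      also have "\<dots> = row_of m S x" using r by (auto simp: t_def Transposition.transpose_def)
      finally show ?thesis .
    qed
    thus ?thesis unfolding act_tabloid tabloid_eq_iff[OF tableau_comp[OF S tm] S] by blast
  qed
  have tC: "t \<in> column_stabilizer l T"
    using tp c by (auto simp: column_stabilizer_iff[OF T] t_def Transposition.transpose_def)
  let ?f = "\<lambda>p. if map ((`) (g \<circ> p)) (tabloid m S) = u then of_int (sign p) else (0::complex)"
  have cc: "p \<circ> t \<circ> t = p" for p by (simp add: comp_assoc tt)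
  have "(\<Sum>p\<in>column_stabilizer l T. ?f p) = (\<Sum>p\<in>column_stabilizer l T. - ?f p)"
  proof (rule sum.reindex_bij_witness[of _ "\<lambda>p. p \<circ> t" "\<lambda>p. p \<circ> t"])
    fix p assume p: "p \<in> column_stabilizer l T"
    have "sign t = - 1" using ab by (simp add: t_def sign_swap_id)
    hence "sign (p \<circ> t) = - sign p" using sign_comp_column_stabilizer[OF p tC] by simp
    moreover have "map ((`) (g \<circ> (p \<circ> t))) (tabloid m S) = map ((`) (g \<circ> p)) (tabloid m S)"
      unfolding comp_assoc[symmetric] act_act[of "g \<circ> p" t, symmetric] ts ..
    ultimately show "- ?f (p \<circ> t) = ?f p" by (simp only: of_int_minus split: if_splits) simp
  qed (use column_stabilizer_comp[OF T _ tC] cc in auto)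
  hence "(\<Sum>p\<in>column_stabilizer l T. ?f p) = 0" by (simp add: sum_negf)
  thus ?thesis unfolding signed_orbit_sum_def .
qed

text \<open>The statistic $\sum_i i \lambda_i$, with rows numbered from \<open>0\<close>. It decreases
  strictly along the dominance order and serves as a numerical substitute for it.\<close>

definition row_weight :: "nat list \<Rightarrow> nat" where
  "row_weight l = (\<Sum>c\<in>diagram l. fst c)"

lemma antimono_column_height:
  assumes "antimono g" "finite (cells g)"
  shows "\<exists>h. \<forall>i j. (i, j) \<in> cells g \<longleftrightarrow> i < h j"
proof -
  have "\<exists>k. \<forall>i. j < g i \<longleftrightarrow> i < k" for j
  proof -
    let ?A = "{i. j < g i}"
    have "(\<lambda>i. (i, j)) ` ?A \<subseteq> cells g" by (auto simp: cells_def)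
    hence "finite ((\<lambda>i. (i, j)) ` ?A)" using assms(2) finite_subset by blast
    hence "finite ?A" by (rule finite_imageD) (auto simp: inj_on_def)
    then obtain i where "\<not> j < g i" by (metis finite_nat_set_iff_bounded less_irrefl mem_Collect_eq)
    define k where "k = (LEAST i. \<not> j < g i)"
    have k: "\<not> j < g k" unfolding k_def by (rule LeastI) fact
    have "j < g i" if "i < k" for i using not_less_Least[of i "\<lambda>i. \<not> j < g i"] that by (auto simp: k_def)
    moreover have "\<not> j < g i" if "k \<le> i" for i using antimonoD[OF assms(1) that] k by simp
    ultimately show ?thesis by (metis not_less)
  qed
  hence "\<exists>h. \<forall>j i. j < g i \<longleftrightarrow> i < h j" by (rule choice[OF allI])
  thus ?thesis by (auto simp: cells_def)
qed

text \<open>Among all sets with prescribed column sizes, the one whose columns are pushed to the top has the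
  least sum of row indices, and it is the only one.\<close>

lemma row_weight_least:
  fixes D :: "(nat \<times> nat) set" and \<phi> :: "nat \<times> nat \<Rightarrow> nat \<times> nat"
  assumes fin: "finite D" and h: "\<And>i j. (i, j) \<in> D \<longleftrightarrow> i < h j"
    and inj: "inj_on \<phi> D" and col: "\<And>c. c \<in> D \<Longrightarrow> snd (\<phi> c) = snd c"
  shows "sum fst D \<le> sum fst (\<phi> ` D)"
    and "sum fst D = sum fst (\<phi> ` D) \<Longrightarrow> \<phi> ` D = D"
proof -
  let ?X = "\<phi> ` D"
  \<comment> \<open>Height above the boundary of the diagram: negative inside \<open>D\<close>, nonnegative outside. As \<open>\<phi>\<close>
    preserves columns, it changes the sum of \<open>w\<close> as much as the sum of the rows.\<close>
  define w where "w = (\<lambda>c :: nat \<times> nat. int (fst c) - int (h (snd c)))"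
  have fX: "finite ?X" using fin by simp
  have hh: "(\<Sum>c\<in>?X. int (h (snd c))) = (\<Sum>c\<in>D. int (h (snd c)))"
    using col by (simp add: sum.reindex[OF inj])
  have "int (sum fst ?X) - int (sum fst D) = sum w ?X - sum w D"
    using hh by (simp add: w_def sum_subtractf)
  also have "\<dots> = sum w (?X - D) - sum w (D - ?X)"
    using sum.Int_Diff[OF fX, of w D] sum.Int_Diff[OF fin, of w ?X] by (simp add: Int_commute)
  also have "\<dots> \<ge> 0 + int (card (D - ?X))"
  proof -
    have "sum w (?X - D) \<ge> 0"
    proof (rule sum_nonneg)
      fix c assume "c \<in> ?X - D"
      thus "0 \<le> w c" using h[of "fst c" "snd c"] by (simp add: w_def)
    qed
    moreover have "sum w (D - ?X) \<le> (\<Sum>c\<in>D - ?X. - 1)"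
    proof (rule sum_mono)
      fix c assume "c \<in> D - ?X"
      thus "w c \<le> - 1" using h[of "fst c" "snd c"] by (simp add: w_def)
    qed
    ultimately show ?thesis by simp
  qed
  finally have *: "int (sum fst D) + int (card (D - ?X)) \<le> int (sum fst ?X)" by simp
  thus "sum fst D \<le> sum fst ?X" by linarith
  assume "sum fst D = sum fst ?X"
  hence "card (D - ?X) = 0" using * by simp
  hence "D \<subseteq> ?X" using fin by auto
  moreover have "card ?X = card D" using inj by (rule card_image)
  ultimately show "?X = D" using card_subset_eq[OF fX] by metis
qed

lemma card_filter_bij: "bij_betw f A B \<Longrightarrow> card {x\<in>A. P (f x)} = card {y\<in>B. P y}"
  by (rule bij_betw_same_card[of f]) (auto simp: bij_betw_def inj_on_def)

text \<open>Replace each cell of \<open>T\<close> by the pair of its column and of the row in which \<open>S\<close> has its entry.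
  Without collisions this is an injection \<open>\<phi>\<close> that moves cells within their columns, and its
  image has as many cells in row \<open>i\<close> as \<open>m\<close> has. So \<open>row_weight_least\<close> compares the weights. In case of
  equality the image is the diagram of \<open>l\<close> itself, and sorting the columns of \<open>T\<close> along \<open>\<phi>\<close>
  is the required column permutation.\<close>

lemma no_collision:
  assumes T: "tableau l T" and S: "tableau m S"
    and l: "l \<in> partitions n" and m: "m \<in> partitions n"
    and nc: "\<And>a b. a \<in> {1..n} \<Longrightarrow> b \<in> {1..n} \<Longrightarrow> a \<noteq> b \<Longrightarrow>
      col_of l T a = col_of l T b \<Longrightarrow> row_of m S a \<noteq> row_of m S b"
  shows "row_weight l \<le> row_weight m"
    and "row_weight l = row_weight m \<Longrightarrow>
      l = m \<and> (\<exists>q\<in>column_stabilizer l T. tabloid m S = tabloid l (q \<circ> T))"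
proof -
  let ?N = "{1..n}"
  have sl: "sum_list l = n" and sm: "sum_list m = n" using l m by (auto simp: partitions_def)
  define D where "D = diagram l"
  define \<phi> where "\<phi> = (\<lambda>c. (row_of m S (T c), snd c))"
  have fD: "finite D" by (simp add: D_def finite_diagram)
  obtain h where h: "\<And>i j. (i, j) \<in> D \<longleftrightarrow> i < h j"
    using antimono_column_height[of "nth_part l"] nth_part_in_young[OF l]
    by (auto simp: D_def diagram_eq_cells young_def)
  have bT: "bij_betw T D ?N" using T by (simp add: tableau_def sl D_def)
  have bS: "bij_betw S (diagram m) ?N" using S by (simp add: tableau_def sm)
  have TN: "T c \<in> ?N" if "c \<in> D" for c using bT that by (auto dest: bij_betwE)
  have inj: "inj_on \<phi> D"
  proof (rule inj_onI, rule ccontr)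
    fix c d assume cd: "c \<in> D" "d \<in> D" "\<phi> c = \<phi> d" "c \<noteq> d"
    have "T c \<noteq> T d" using cd bT by (auto simp: bij_betw_def inj_on_def)
    moreover have "col_of l T (T c) = col_of l T (T d)"
      using cd row_col_tableau[OF T] by (simp add: D_def \<phi>_def)
    ultimately have "row_of m S (T c) \<noteq> row_of m S (T d)" using nc TN cd by blast
    thus False using cd by (simp add: \<phi>_def)
  qed
  have sX: "sum fst (\<phi> ` D) = row_weight m"
  proof -
    have "sum fst (\<phi> ` D) = (\<Sum>c\<in>D. row_of m S (T c))"
      unfolding sum.reindex[OF inj] by (simp add: \<phi>_def)
    also have "\<dots> = (\<Sum>a\<in>?N. row_of m S a)" by (rule sum.reindex_bij_betw[OF bT])
    also have "\<dots> = (\<Sum>c\<in>diagram m. row_of m S (S c))" by (rule sum.reindex_bij_betw[OF bS, symmetric])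
    also have "\<dots> = row_weight m" unfolding row_weight_def
      using row_col_tableau[OF S] by (intro sum.cong) auto
    finally show ?thesis .
  qed
  have sD: "sum fst D = row_weight l" by (simp add: D_def row_weight_def)
  note least = row_weight_least[OF fD h inj, unfolded sX sD]
  have col: "snd (\<phi> c) = snd c" for c by (simp add: \<phi>_def)
  show "row_weight l \<le> row_weight m" using least(1) col by blast
  assume eq: "row_weight l = row_weight m"
  have X: "\<phi> ` D = D" using least(2) col eq by blast
  have b\<phi>: "bij_betw \<phi> D D" using inj X by (simp add: bij_betw_def)
  have pc: "nth_part k i = card {c\<in>diagram k. fst c = i}" for k i
  proof -
    have "{c\<in>diagram k. fst c = i} = Pair i ` {..<nth_part k i}"
      by (auto simp: diagram_eq_cells cells_def)
    thus ?thesis by (simp add: card_image inj_on_def)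
  qed
  have "nth_part m i = nth_part l i" for i
  proof -
    have "card {c\<in>diagram m. row_of m S (S c) = i} = card {a\<in>?N. row_of m S a = i}"
      by (rule card_filter_bij[OF bS])
    moreover have "{c\<in>diagram m. row_of m S (S c) = i} = {c\<in>diagram m. fst c = i}"
      using row_col_tableau(1)[OF S] by auto
    ultimately have 1: "nth_part m i = card {a\<in>?N. row_of m S a = i}" unfolding pc by simp
    have "card {c\<in>D. row_of m S (T c) = i} = card {a\<in>?N. row_of m S a = i}"
      by (rule card_filter_bij[OF bT])
    hence 2: "card {c\<in>D. fst (\<phi> c) = i} = card {a\<in>?N. row_of m S a = i}" by (simp add: \<phi>_def)
    have 3: "card {c\<in>D. fst (\<phi> c) = i} = nth_part l i"
      unfolding pc D_def[symmetric] by (rule card_filter_bij[OF b\<phi>])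
    show ?thesis using 1 2 3 by simp
  qed
  hence lm: "l = m" using inj_on_nth_part[of n] l m by (auto simp: inj_on_def fun_eq_iff)
  \<comment> \<open>The entry that \<open>T\<close> has in the cell \<open>\<phi> c\<close> is replaced by the one in \<open>c\<close>.\<close>
  define q where "q = (\<lambda>a. if a \<in> ?N then T (inv_into D \<phi> (inv_into D T a)) else a)"
  have q: "q (T (\<phi> c)) = T c" if "c \<in> D" for c
  proof -
    have \<phi>c: "\<phi> c \<in> D" using X that by blast
    have "inv_into D T (T (\<phi> c)) = \<phi> c" using bT \<phi>c by (simp add: bij_betw_def)
    moreover have "inv_into D \<phi> (\<phi> c) = c" using inj that by simp
    ultimately show ?thesis using TN[OF \<phi>c] by (simp add: q_def)
  qed
  have TX: "\<exists>c\<in>D. a = T (\<phi> c)" if "a \<in> ?N" for a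
  proof -
    have "a \<in> T ` D" using bij_betw_imp_surj_on[OF bT] that by simp
    then obtain d where d: "a = T d" "d \<in> D" by (rule imageE)
    hence "d \<in> \<phi> ` D" using X by simp
    then obtain c where "d = \<phi> c" "c \<in> D" by (rule imageE)
    thus ?thesis using d by blast
  qed
  have "bij_betw (T \<circ> inv_into D \<phi> \<circ> inv_into D T) ?N ?N"
    using bij_betw_trans[OF bij_betw_inv_into[OF bT] bij_betw_trans[OF bij_betw_inv_into[OF b\<phi>] bT]]
    by (simp add: comp_assoc)
  hence "bij_betw q ?N ?N" by (rule bij_betw_cong[THEN iffD1, rotated]) (simp add: q_def)
  hence qp: "q permutes ?N" by (rule bij_imp_permutes) (auto simp: q_def)
  hence qp': "q permutes {1..sum_list l}" by (simp add: sl)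
  have "col_of l T (q a) = col_of l T a" if a: "a \<in> {1..sum_list l}" for a
  proof -
    obtain c where c: "c \<in> D" "a = T (\<phi> c)" using TX[OF a[unfolded sl]] by (rule bexE)
    have \<phi>c: "\<phi> c \<in> D" using imageI[OF c(1), of \<phi>] unfolding X .
    have "col_of l T (q a) = snd c"
      unfolding c(2) q[OF c(1)] using c(1) unfolding D_def by (rule row_col_tableau(2)[OF T])
    moreover have "col_of l T a = snd (\<phi> c)"
      unfolding c(2) using \<phi>c unfolding D_def by (rule row_col_tableau(2)[OF T])
    ultimately show ?thesis by (simp only: col)
  qed
  hence qC: "q \<in> column_stabilizer l T" using qp' column_stabilizer_iff[OF T] by blast
  have "row_of l S a = row_of l (q \<circ> T) a" if a: "a \<in> {1..sum_list l}" for a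
  proof -
    have "a \<in> q ` ?N" using a unfolding permutes_image[OF qp] sl .
    then obtain b where b: "a = q b" "b \<in> ?N" by (rule imageE)
    obtain c where c: "c \<in> D" "b = T (\<phi> c)" using TX[OF b(2)] by (rule bexE)
    have \<phi>c: "\<phi> c \<in> D" using imageI[OF c(1), of \<phi>] unfolding X .
    have "row_of l (q \<circ> T) a = row_of l T b"
      unfolding b(1) by (rule row_col_comp(1)[OF T qp' b(2)[folded sl]])
    also have "\<dots> = fst (\<phi> c)"
      unfolding c(2) using \<phi>c unfolding D_def by (rule row_col_tableau(1)[OF T])
    also have "\<dots> = row_of m S (T c)" by (simp add: \<phi>_def)
    also have "T c = a" unfolding b(1) c(2) by (rule q[OF c(1), symmetric])
    finally have "row_of l (q \<circ> T) a = row_of m S a" .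
    thus ?thesis unfolding lm by (rule sym)
  qed
  moreover have "tableau l S" using S lm by simp
  ultimately have "tabloid l S = tabloid l (q \<circ> T)"
    using tabloid_eq_iff[OF _ tableau_comp[OF T qp']] by simp
  thus "l = m \<and> (\<exists>q\<in>column_stabilizer l T. tabloid m S = tabloid l (q \<circ> T))"
    using lm qC by (intro conjI bexI[of _ q]) simp_all
qed

lemma signed_orbit_sum_other_shape:
  assumes T: "tableau l T" and S: "tableau m S"
    and l: "l \<in> partitions n" and m: "m \<in> partitions n"
    and "l \<noteq> m" "row_weight m \<le> row_weight l"
  shows "signed_orbit_sum l T g (tabloid m S) u = 0"
proof -
  have s: "sum_list l = n" "sum_list m = n" using l m by (auto simp: partitions_def)
  have "\<exists>a\<in>{1..n}. \<exists>b\<in>{1..n}. a \<noteq> b \<and> col_of l T a = col_of l T b \<and> row_of m S a = row_of m S b"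
    using no_collision[OF T S l m] assms(5,6) by (meson le_antisym)
  thus ?thesis using signed_orbit_sum_collision[OF T S] s by auto
qed

lemma act_inv_iff:
  assumes "p permutes N"
  shows "map ((`) p) s = u \<longleftrightarrow> s = map ((`) (inv p)) u"
  using act_act[of p "inv p" u] act_act[of "inv p" p s] permutes_inv_o[OF assms] by auto

text \<open>The inversion $p \mapsto p^{-1}$ of the column stabilizer turns the coefficient of \<open>u\<close> in
  $\kappa_T \{T\}$ into the coefficient of $\{T\}$ in $\kappa_T u$.\<close>

lemma lookup_polytabloid_inv:
  assumes T: "tableau l T"
  shows "Poly_Mapping.lookup (polytabloid l T) u = signed_orbit_sum l T id u (tabloid l T)"
  unfolding lookup_polytabloid signed_orbit_sum_def
proof (rule sum.reindex_bij_witness[of _ inv inv])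
  fix p assume p: "p \<in> column_stabilizer l T"
  note P = column_stabilizer_permutes[OF p]
  show "inv (inv p) = p" by (rule permutes_inv_inv[OF P])
  show "inv p \<in> column_stabilizer l T" by (rule column_stabilizer_inv[OF T p])
  have "sign (inv p) = sign p" using P by (intro sign_inverse) (auto simp: permutation_permutes)
  thus "(if map ((`) (id \<circ> inv p)) u = tabloid l T then of_int (sign (inv p)) else 0) =
    (if map ((`) p) (tabloid l T) = u then of_int (sign p) else 0)"
    using act_inv_iff[OF P, of "tabloid l T" u] by auto
next
  fix p assume p: "p \<in> column_stabilizer l T"
  show "inv (inv p) = p" by (rule permutes_inv_inv[OF column_stabilizer_permutes[OF p]])
  show "inv p \<in> column_stabilizer l T" by (rule column_stabilizer_inv[OF T p])
qed

lemma lookup_polytabloid_comp: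
  assumes T: "tableau l T" and g: "g permutes {1..sum_list l}"
  shows "Poly_Mapping.lookup (polytabloid l (g \<circ> T)) u = signed_orbit_sum l T g (tabloid l T) u"
  unfolding lookup_polytabloid signed_orbit_sum_def
proof (rule sum.reindex_bij_witness[of _ "\<lambda>p. g \<circ> p \<circ> inv g" "\<lambda>p. inv g \<circ> p \<circ> g"])
  have gg: "g \<circ> inv g = id" "inv g \<circ> g = id" using permutes_inv_o[OF g] by auto
  have c1: "inv g \<circ> (g \<circ> p \<circ> inv g) \<circ> g = p" for p
    using gg by (metis comp_assoc comp_id id_comp)
  have c2: "g \<circ> (inv g \<circ> p \<circ> g) \<circ> inv g = p" for p
    using gg by (metis comp_assoc comp_id id_comp)
  have mem: "inv g \<circ> p \<circ> g \<in> column_stabilizer l T" if "p \<in> column_stabilizer l (g \<circ> T)" for p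
    using column_stabilizer_conj[OF T g, of "inv g \<circ> p \<circ> g"] that by (simp only: c2)
  fix p
  {
    assume p: "p \<in> column_stabilizer l (g \<circ> T)"
    show "g \<circ> (inv g \<circ> p \<circ> g) \<circ> inv g = p" by (rule c2)
    show "inv g \<circ> p \<circ> g \<in> column_stabilizer l T" by (rule mem[OF p])
    have P: "permutation p" "permutation g" "permutation (inv g)"
      using column_stabilizer_permutes[OF p] g permutes_inv[OF g] by (auto simp: permutation_permutes)
    have "sign (inv g \<circ> p \<circ> g) = sign p"
      using P sign_inverse[OF P(2)] by (simp add: sign_compose permutation_compose sign_idempotent)
    moreover have "map ((`) (g \<circ> (inv g \<circ> p \<circ> g))) (tabloid l T) = map ((`) p) (tabloid l (g \<circ> T))"
      unfolding act_tabloid[symmetric] act_act using gg by (metis comp_assoc id_comp)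
    ultimately show "(if map ((`) (g \<circ> (inv g \<circ> p \<circ> g))) (tabloid l T) = u then of_int (sign (inv g \<circ> p \<circ> g)) else 0) =
      (if map ((`) p) (tabloid l (g \<circ> T)) = u then of_int (sign p) else 0)" by simp
  }
  assume p: "p \<in> column_stabilizer l T"
  show "inv g \<circ> (g \<circ> p \<circ> inv g) \<circ> g = p" by (rule c1)
  show "g \<circ> p \<circ> inv g \<in> column_stabilizer l (g \<circ> T)" using column_stabilizer_conj[OF T g] p by blast
qed

text \<open>On the permutation module of its own shape, $\kappa_T$ acts as the operator of rank one
  $s \mapsto e_T(s) \, e_T$: either there is a collision and both sides vanish, or $s = q \{T\}$ with
  a unique \<open>q\<close> in the column stabilizer.\<close>

lemma signed_orbit_sum_same_shape:
  assumes T: "tableau l T" and S: "tableau l S" and l: "l \<in> partitions n" and g: "g permutes {1..n}"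
  shows "signed_orbit_sum l T g (tabloid l S) u =
    Poly_Mapping.lookup (polytabloid l T) (tabloid l S) * Poly_Mapping.lookup (polytabloid l (g \<circ> T)) u"
proof -
  have s: "sum_list l = n" using l by (auto simp: partitions_def)
  show ?thesis
  proof (cases "\<exists>a\<in>{1..n}. \<exists>b\<in>{1..n}. a \<noteq> b \<and> col_of l T a = col_of l T b \<and> row_of l S a = row_of l S b")
    case True
    hence "signed_orbit_sum l T g' (tabloid l S) u' = 0" for g' u'
      using signed_orbit_sum_collision[OF T S] s by auto
    thus ?thesis by (simp add: lookup_polytabloid_inv[OF T])
  next
    case False
    hence "\<exists>q\<in>column_stabilizer l T. tabloid l S = tabloid l (q \<circ> T)"
      using no_collision(2)[OF T S l l] by meson
    then obtain q where q: "q \<in> column_stabilizer l T" and Sq: "tabloid l S = map ((`) q) (tabloid l T)"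
      by (auto simp: act_tabloid)
    note Q = column_stabilizer_permutes[OF q] and iq = column_stabilizer_inv[OF T q]
    have qq: "q \<circ> inv q = id" "inv q \<circ> q = id" using permutes_inv_o[OF Q] by auto
    have "Poly_Mapping.lookup (polytabloid l T) (tabloid l S) =
      (\<Sum>p\<in>column_stabilizer l T. if p = q then of_int (sign p) else 0)"
      unfolding lookup_polytabloid Sq
      by (rule sum.cong) (use column_stabilizer_tabloid_inj[OF T _ q] in auto)
    hence 1: "Poly_Mapping.lookup (polytabloid l T) (tabloid l S) = of_int (sign q)"
      using q by (simp add: finite_column_stabilizer)
    have sq: "sign (inv q) = sign q" using Q by (intro sign_inverse) (auto simp: permutation_permutes)
    have c: "p \<circ> q \<circ> inv q = p" "p \<circ> inv q \<circ> q = p" for p using qq by (simp_all add: comp_assoc)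
    have "signed_orbit_sum l T g (tabloid l S) u =
      (\<Sum>p\<in>column_stabilizer l T. of_int (sign q) * (if map ((`) (g \<circ> p)) (tabloid l T) = u then of_int (sign p) else 0))"
      unfolding signed_orbit_sum_def Sq act_act
    proof (rule sum.reindex_bij_witness[of _ "\<lambda>p. p \<circ> inv q" "\<lambda>p. p \<circ> q"])
      fix p assume p: "p \<in> column_stabilizer l T"
      show "p \<circ> q \<circ> inv q = p" "p \<circ> inv q \<circ> q = p" by (rule c)+
      show "p \<circ> q \<in> column_stabilizer l T" by (rule column_stabilizer_comp[OF T p q])
      show "p \<circ> inv q \<in> column_stabilizer l T" by (rule column_stabilizer_comp[OF T p iq])
      have "sign q * sign (p \<circ> q) = sign p"
        using sign_comp_column_stabilizer[OF p q] sign_idempotent[of q] by (simp add: mult_ac)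
      hence "of_int (sign q) * of_int (sign (p \<circ> q)) = (of_int (sign p) :: complex)"
        by (metis of_int_mult)
      thus "of_int (sign q) * (if map ((`) (g \<circ> (p \<circ> q))) (tabloid l T) = u then of_int (sign (p \<circ> q)) else 0) =
        (if map ((`) (g \<circ> p \<circ> q)) (tabloid l T) = u then of_int (sign p) else (0::complex))"
        by (simp add: comp_assoc)
    qed
    also have "\<dots> = of_int (sign q) * signed_orbit_sum l T g (tabloid l T) u"
      by (simp add: signed_orbit_sum_def sum_distrib_left)
    also have "signed_orbit_sum l T g (tabloid l T) u = Poly_Mapping.lookup (polytabloid l (g \<circ> T)) u"
      using lookup_polytabloid_comp[OF T] g s by simp
    finally show ?thesis using 1 by simp
  qed
qed

section \<open>Upper bound for the dimensions of Specht modules\<close>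

text \<open>Linear independence of families, in contrast to that of sets, includes injectivity. This form
  hides the reindexing.\<close>

lemma card_le_of_independent_family:
  fixes v :: "'i \<Rightarrow> ('a \<Rightarrow>\<^sub>0 complex)"
  assumes I: "finite I" and S: "finite S" and span: "\<And>i. i \<in> I \<Longrightarrow> v i \<in> formal.span S"
    and ind: "\<And>c i. (\<Sum>i\<in>I. formal_scale (c i) (v i)) = 0 \<Longrightarrow> i \<in> I \<Longrightarrow> c i = 0"
  shows "card I \<le> card S"
proof -
  have inj: "inj_on v I"
  proof (rule inj_onI, rule ccontr)
    fix i j assume ij: "i \<in> I" "j \<in> I" "v i = v j" "i \<noteq> j"
    define c where "c = (\<lambda>k. if k = i then 1 else if k = j then - 1 else (0::complex))"
    have "(\<Sum>k\<in>I. formal_scale (c k) (v k)) = (\<Sum>k\<in>{i,j}. formal_scale (c k) (v k))"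
      using ij I by (intro sum.mono_neutral_right) (auto simp: c_def)
    also have "\<dots> = 0" using ij by (simp add: c_def)
    finally have "c i = 0" using ind ij by blast
    thus False by (simp add: c_def)
  qed
  have "\<not> formal.dependent (v ` I)"
  proof
    assume "formal.dependent (v ` I)"
    then obtain u w where w: "w \<in> v ` I" "u w \<noteq> 0" and s: "(\<Sum>w\<in>v ` I. formal_scale (u w) w) = 0"
      using formal.dependent_finite[of "v ` I"] I by auto
    from s have "(\<Sum>i\<in>I. formal_scale (u (v i)) (v i)) = 0" by (simp add: sum.reindex[OF inj])
    from ind[OF this] w show False by auto
  qed
  hence "card (v ` I) \<le> card S"
    using formal.independent_span_bound[OF S, of "v ` I"] span by auto
  thus ?thesis by (simp add: card_image[OF inj])
qed

lemma polytabloid_in_span: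
  assumes "tableau l T"
  shows "polytabloid l T \<in> formal.span ((\<lambda>t. Poly_Mapping.single t 1) ` {t. set t \<subseteq> Pow {1..sum_list l} \<and> length t = length l})"
    (is "_ \<in> formal.span ?F")
  unfolding polytabloid_def
proof (rule formal.span_sum)
  fix p assume p: "p \<in> column_stabilizer l T"
  let ?t = "map ((`) p) (tabloid l T)"
  have pt: "tableau l (p \<circ> T)" using tableau_comp[OF assms column_stabilizer_permutes[OF p]] .
  have "?t \<in> {t. set t \<subseteq> Pow {1..sum_list l} \<and> length t = length l}"
    unfolding act_tabloid tabloid_eq[OF pt] by auto
  hence "Poly_Mapping.single ?t 1 \<in> ?F" by blast
  hence "formal_scale (of_int (sign p)) (Poly_Mapping.single ?t 1) \<in> formal.span ?F"
    by (intro formal.span_scale formal.span_base)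
  moreover have "formal_scale c (Poly_Mapping.single t 1) = Poly_Mapping.single t c" for c and t :: "nat set list"
    by (rule poly_mapping_eqI) (simp add: lookup_single when_def)
  ultimately show "Poly_Mapping.single ?t (of_int (sign p)) \<in> formal.span ?F" by simp
qed

text \<open>A basis of the Specht module that consists of polytabloids is recorded through the tableaux.\<close>

definition specht_basis :: "nat list \<Rightarrow> (nat \<times> nat \<Rightarrow> nat) set \<Rightarrow> bool" where
  "specht_basis l B \<longleftrightarrow> finite B \<and> (\<forall>T\<in>B. tableau l T) \<and> card B = specht_dim l \<and>
     formal.span (polytabloid l ` B) = specht_module l \<and>
     (\<forall>c. (\<Sum>T\<in>B. formal_scale (c T) (polytabloid l T)) = 0 \<longrightarrow> (\<forall>T\<in>B. c T = 0))"

lemma specht_basis_exists: "\<exists>B. specht_basis l B"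
proof -
  let ?V = "{polytabloid l T | T. tableau l T}"
  let ?F = "(\<lambda>t. Poly_Mapping.single t (1::complex)) ` {t. set t \<subseteq> Pow {1..sum_list l} \<and> length t = length l}"
  obtain C where C: "C \<subseteq> ?V" "formal.independent C" "?V \<subseteq> formal.span C"
    using formal.maximal_independent_subset[of ?V] by blast
  have "finite {t. set t \<subseteq> Pow {1..sum_list l} \<and> length t = length l}"
    by (rule finite_lists_length_eq) simp
  hence fF: "finite ?F" by simp
  have "C \<subseteq> formal.span ?F" using C(1) polytabloid_in_span by blast
  hence fC: "finite C" using formal.independent_span_bound[OF fF C(2)] by blast
  have sp: "formal.span C = specht_module l"
    using C formal.span_mono[OF C(1)] formal.span_minimal[OF C(3) formal.subspace_span]
    by (auto simp: specht_module_def)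
  have cC: "card C = specht_dim l"
    unfolding specht_dim_def using formal.dim_eq_card[OF _ C(2), of "specht_module l"] sp
    by (simp add: formal.span_span specht_module_def)
  have "\<forall>w\<in>C. \<exists>T. tableau l T \<and> polytabloid l T = w" using C(1) by blast
  then obtain f where f: "\<And>w. w \<in> C \<Longrightarrow> tableau l (f w)" "\<And>w. w \<in> C \<Longrightarrow> polytabloid l (f w) = w" by metis
  have inj: "inj_on f C" using f(2) by (metis inj_onI)
  have im: "polytabloid l ` f ` C = C" using f(2) by (force simp: image_iff)
  have "specht_basis l (f ` C)"
    unfolding specht_basis_def
  proof (intro conjI ballI allI impI)
    show "finite (f ` C)" using fC by simp
    show "tableau l T" if "T \<in> f ` C" for T using that f by blast
    show "card (f ` C) = specht_dim l" using cC card_image[OF inj] by simp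
    show "formal.span (polytabloid l ` f ` C) = specht_module l" using im sp by simp
    fix c T assume s: "(\<Sum>T\<in>f ` C. formal_scale (c T) (polytabloid l T)) = 0" and T: "T \<in> f ` C"
    have "(\<Sum>w\<in>C. formal_scale (c (f w)) w) = 0"
      using s f(2) by (simp add: sum.reindex[OF inj])
    moreover obtain w where "w \<in> C" "T = f w" using T by blast
    ultimately show "c T = 0"
      using C(2) formal.dependent_finite[OF fC] by (metis)
  qed
  thus ?thesis by blast
qed

text \<open>The permutation $g$ with $g \circ T' = T$ on the diagram.\<close>

definition relabel :: "nat list \<Rightarrow> (nat \<times> nat \<Rightarrow> nat) \<Rightarrow> (nat \<times> nat \<Rightarrow> nat) \<Rightarrow> nat \<Rightarrow> nat" where
  "relabel l T T' a = (if a \<in> {1..sum_list l} then T (inv_into (diagram l) T' a) else a)"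

lemma relabel_permutes:
  assumes "tableau l T" "tableau l T'"
  shows "relabel l T T' permutes {1..sum_list l}"
proof (rule bij_imp_permutes)
  have "bij_betw (T \<circ> inv_into (diagram l) T') {1..sum_list l} {1..sum_list l}"
    using assms unfolding tableau_def by (blast intro: bij_betw_trans bij_betw_inv_into)
  thus "bij_betw (relabel l T T') {1..sum_list l} {1..sum_list l}"
    by (rule bij_betw_cong[THEN iffD1, rotated]) (simp add: relabel_def)
qed (auto simp: relabel_def)

lemma polytabloid_relabel:
  assumes "tableau l T" "tableau l T'"
  shows "polytabloid l (relabel l T T' \<circ> T') = polytabloid l T"
proof (rule polytabloid_cong)
  fix c assume c: "c \<in> diagram l"
  thus "(relabel l T T' \<circ> T') c = T c"
    using tableau_mem[OF assms(2) c] assms(2) by (simp add: relabel_def tableau_def bij_betw_def)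
qed

text \<open>The element $g \kappa_{T'}$ of the group algebra, where $g T' = T$. On the permutation module of
  shape \<open>l\<close> it acts as the operator of rank one $s \mapsto e_{T'}(s) \, e_T$. As \<open>T\<close> and \<open>T'\<close>
  run through a basis, these operators are linearly independent.\<close>

definition matrix_unit ::
    "nat list \<Rightarrow> (nat \<times> nat \<Rightarrow> nat) \<Rightarrow> (nat \<times> nat \<Rightarrow> nat) \<Rightarrow> ((nat \<Rightarrow> nat) \<Rightarrow>\<^sub>0 complex)" where
  "matrix_unit l T T' = (\<Sum>p\<in>column_stabilizer l T'.
     Poly_Mapping.single (relabel l T T' \<circ> p) (of_int (sign p)))"

text \<open>The coefficient of the tabloid \<open>u\<close> in $v s$, for \<open>v\<close> in the group algebra.\<close>

definition act_coeff :: "nat \<Rightarrow> nat set list \<Rightarrow> nat set list \<Rightarrow> ((nat \<Rightarrow> nat) \<Rightarrow>\<^sub>0 complex) \<Rightarrow> complex" where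
  "act_coeff n s u v = (\<Sum>h\<in>{h. h permutes {1..n}}. if map ((`) h) s = u then Poly_Mapping.lookup v h else 0)"

lemma act_coeff_sum:
  "act_coeff n s u (\<Sum>i\<in>I. formal_scale (c i) (v i)) = (\<Sum>i\<in>I. c i * act_coeff n s u (v i))"
proof -
  have "act_coeff n s u (\<Sum>i\<in>I. formal_scale (c i) (v i)) =
    (\<Sum>h\<in>{h. h permutes {1..n}}. \<Sum>i\<in>I. c i * (if map ((`) h) s = u then Poly_Mapping.lookup (v i) h else 0))"
    unfolding act_coeff_def by (intro sum.cong) (auto simp: lookup_sum)
  also have "\<dots> = (\<Sum>i\<in>I. c i * act_coeff n s u (v i))"
    unfolding act_coeff_def by (subst sum.swap) (simp add: sum_distrib_left)
  finally show ?thesis .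
qed

lemma act_coeff_matrix_unit:
  assumes T: "tableau l T" "tableau l T'" and n: "sum_list l = n"
  shows "act_coeff n s u (matrix_unit l T T') = signed_orbit_sum l T' (relabel l T T') s u"
proof -
  let ?G = "{h. h permutes {1..n}}" and ?g = "relabel l T T'"
  have gp: "?g \<circ> p \<in> ?G" if "p \<in> column_stabilizer l T'" for p
    using permutes_compose[OF column_stabilizer_permutes[OF that] relabel_permutes[OF T]] n by simp
  have "act_coeff n s u (matrix_unit l T T') =
    (\<Sum>h\<in>?G. \<Sum>p\<in>column_stabilizer l T'. if ?g \<circ> p = h then (if map ((`) h) s = u then of_int (sign p) else 0) else 0)"
    unfolding act_coeff_def matrix_unit_def
  proof (intro sum.cong refl)
    fix h
    show "(if map ((`) h) s = u then Poly_Mapping.lookup (\<Sum>p\<in>column_stabilizer l T'.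
        Poly_Mapping.single (?g \<circ> p) (of_int (sign p))) h else 0) =
      (\<Sum>p\<in>column_stabilizer l T'. if ?g \<circ> p = h then if map ((`) h) s = u then of_int (sign p) else 0 else (0::complex))"
    proof (cases "map ((`) h) s = u")
      case True
      show ?thesis unfolding if_P[OF True] by (simp add: lookup_sum lookup_single when_def)
    next
      case False
      show ?thesis unfolding if_not_P[OF False] by simp
    qed
  qed
  also have "\<dots> = (\<Sum>p\<in>column_stabilizer l T'. \<Sum>h\<in>?G. if ?g \<circ> p = h then (if map ((`) h) s = u then of_int (sign p) else 0) else 0)"
    by (rule sum.swap)
  also have "\<dots> = signed_orbit_sum l T' ?g s u"
    unfolding signed_orbit_sum_def
  proof (rule sum.cong)
    fix p assume p: "p \<in> column_stabilizer l T'"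
    show "(\<Sum>h\<in>?G. if ?g \<circ> p = h then (if map ((`) h) s = u then of_int (sign p) else 0) else 0) =
      (if map ((`) (?g \<circ> p)) s = u then of_int (sign p) else (0::complex))"
      using sum.delta'[of ?G "?g \<circ> p" "\<lambda>h. if map ((`) h) s = u then of_int (sign p) else (0::complex)"]
        gp[OF p] finite_permutations[of "{1..n}"] by simp
  qed simp
  finally show ?thesis .
qed

text \<open>For each partition \<open>l\<close> take the $d_l^2$ elements \<open>matrix_unit l T T'\<close> that belong to a basis of polytabloids.
  Together they are linearly independent in the group algebra, whose dimension is $n!$. Indeed, among
  the shapes that occur in a linear relation choose one of least row weight: on its permutation
  module all other shapes of the relation act as zero, and what remains is a relation between
  independent operators of rank one.\<close>

lemma sum_specht_dim_squared_le: "(\<Sum>l\<in>partitions n. (specht_dim l)\<^sup>2) \<le> fact n"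
proof -
  have "\<exists>B. \<forall>l. specht_basis l (B l)" by (intro choice allI specht_basis_exists)
  then obtain B where basis: "\<forall>l. specht_basis l (B l)" by (rule exE)
  have B: "\<And>l. finite (B l)" "\<And>l T. T \<in> B l \<Longrightarrow> tableau l T" "\<And>l. card (B l) = specht_dim l"
    "\<And>l c T. (\<Sum>T\<in>B l. formal_scale (c T) (polytabloid l T)) = 0 \<Longrightarrow> T \<in> B l \<Longrightarrow> c T = 0"
    using basis unfolding specht_basis_def by simp_all
  define I where "I = (SIGMA l:partitions n. B l \<times> B l)"
  define v where "v = (\<lambda>(l, T, T'). matrix_unit l T T')"
  let ?G = "{h. h permutes {1..n}}"
  let ?S = "(\<lambda>h. Poly_Mapping.single h (1::complex)) ` ?G"
  have fG: "finite ?G" by (simp add: finite_permutations)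
  have fI: "finite I" using B(1) finite_partitions by (simp add: I_def)
  have sl: "sum_list l = n" if "l \<in> partitions n" for l using that by (simp add: partitions_def)
  have "card I \<le> card ?S"
  proof (rule card_le_of_independent_family[of I ?S v])
    show "finite I" "finite ?S" using fI fG by auto
  next
    fix i assume "i \<in> I"
    then obtain l T T' where i: "i = (l, T, T')" "l \<in> partitions n" "T \<in> B l" "T' \<in> B l"
      by (auto simp: I_def)
    show "v i \<in> formal.span ?S"
      unfolding i v_def split_conv matrix_unit_def
    proof (rule formal.span_sum)
      fix p assume p: "p \<in> column_stabilizer l T'"
      have "relabel l T T' \<circ> p \<in> ?G"
        using permutes_compose[OF column_stabilizer_permutes[OF p] relabel_permutes[OF B(2)[OF i(3)] B(2)[OF i(4)]]]
          sl[OF i(2)] by simp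
      hence "formal_scale (of_int (sign p)) (Poly_Mapping.single (relabel l T T' \<circ> p) 1) \<in> formal.span ?S"
        by (intro formal.span_scale formal.span_base) blast
      moreover have "formal_scale c (Poly_Mapping.single t 1) = Poly_Mapping.single t c" for c and t :: "nat \<Rightarrow> nat"
        by (rule poly_mapping_eqI) (simp add: lookup_single when_def)
      ultimately show "Poly_Mapping.single (relabel l T T' \<circ> p) (of_int (sign p)) \<in> formal.span ?S" by simp
    qed
  next
    fix c i assume zero: "(\<Sum>i\<in>I. formal_scale (c i) (v i)) = 0" and i: "i \<in> I"
    show "c i = 0"
    proof (rule ccontr)
      assume "c i \<noteq> 0"
      with i have ex: "\<exists>l. \<exists>T\<in>B l. \<exists>T'\<in>B l. l \<in> partitions n \<and> c (l, T, T') \<noteq> 0" by (auto simp: I_def)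
      \<comment> \<open>The shapes that occur in the relation.\<close>
      define P where "P = (\<lambda>l. l \<in> partitions n \<and> (\<exists>T\<in>B l. \<exists>T'\<in>B l. c (l, T, T') \<noteq> 0))"
      have "\<exists>l. P l" using ex by (auto simp: P_def)
      then obtain m where m: "P m" and least: "\<And>l. P l \<Longrightarrow> row_weight m \<le> row_weight l"
        using ex_has_least_nat[of P _ row_weight] by blast
      have mn: "m \<in> partitions n" using m by (simp add: P_def)
      have key: "(\<Sum>T'\<in>B m. c (m, T, T') * Poly_Mapping.lookup (polytabloid m T') (tabloid m S)) = 0"
        if T: "T \<in> B m" and S: "tableau m S" for T S
      proof -
        let ?s = "tabloid m S"
        let ?a = "\<lambda>T. \<Sum>T'\<in>B m. c (m, T, T') * Poly_Mapping.lookup (polytabloid m T') ?s"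
        \<comment> \<open>Apply the relation to the tabloid of \<open>S\<close> and compare the coefficients of every \<open>u\<close>.\<close>
        have "(\<Sum>T\<in>B m. formal_scale (?a T) (polytabloid m T)) = 0"
        proof (rule poly_mapping_eqI)
          fix u
          let ?x = "\<lambda>l T T'. c (l, T, T') * act_coeff n ?s u (matrix_unit l T T')"
          have other: "(\<Sum>T\<in>B l. \<Sum>T'\<in>B l. ?x l T T') = 0" if l: "l \<in> partitions n - {m}" for l
          proof (cases "P l")
            case False
            thus ?thesis using l by (auto simp: P_def)
          next
            case True
            have "act_coeff n ?s u (matrix_unit l T T') = 0" if "T \<in> B l" "T' \<in> B l" for T T'
              using signed_orbit_sum_other_shape[OF B(2)[OF that(2)] S _ mn] l least[OF True]
                act_coeff_matrix_unit[OF B(2)[OF that(1)] B(2)[OF that(2)]] sl by auto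
            thus ?thesis by simp
          qed
          have "0 = act_coeff n ?s u (\<Sum>i\<in>I. formal_scale (c i) (v i))"
            by (simp add: zero act_coeff_def cong: if_cong)
          also have "\<dots> = (\<Sum>(l, T, T')\<in>I. ?x l T T')"
            unfolding act_coeff_sum v_def by (intro sum.cong) auto
          also have "\<dots> = (\<Sum>l\<in>partitions n. \<Sum>(T, T')\<in>B l \<times> B l. ?x l T T')"
            unfolding I_def using finite_partitions B(1) by (subst sum.Sigma) auto
          also have "\<dots> = (\<Sum>l\<in>partitions n. \<Sum>T\<in>B l. \<Sum>T'\<in>B l. ?x l T T')"
            by (simp add: sum.cartesian_product)
          also have "\<dots> = (\<Sum>T\<in>B m. \<Sum>T'\<in>B m. ?x m T T')"
            using sum.remove[OF finite_partitions mn, of "\<lambda>l. \<Sum>T\<in>B l. \<Sum>T'\<in>B l. ?x l T T'"] other by simp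
          also have "\<dots> = (\<Sum>T\<in>B m. \<Sum>T'\<in>B m. c (m, T, T') * Poly_Mapping.lookup (polytabloid m T') ?s * Poly_Mapping.lookup (polytabloid m T) u)"
          proof (intro sum.cong refl)
            fix T T' assume TT: "T \<in> B m" "T' \<in> B m"
            note t = B(2)[OF TT(1)] B(2)[OF TT(2)]
            show "?x m T T' = c (m, T, T') * Poly_Mapping.lookup (polytabloid m T') ?s * Poly_Mapping.lookup (polytabloid m T) u"
              using signed_orbit_sum_same_shape[OF t(2) S mn, of "relabel m T T'" u] relabel_permutes[OF t]
                act_coeff_matrix_unit[OF t sl[OF mn]] sl[OF mn] polytabloid_relabel[OF t] by simp
          qed
          also have "\<dots> = Poly_Mapping.lookup (\<Sum>T\<in>B m. formal_scale (?a T) (polytabloid m T)) u"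
            by (simp add: lookup_sum sum_distrib_right)
          finally show "Poly_Mapping.lookup (\<Sum>T\<in>B m. formal_scale (?a T) (polytabloid m T)) u = Poly_Mapping.lookup 0 u"
            by simp
        qed
        from B(4)[OF this T] show ?thesis .
      qed
      have "c (m, T, T') = 0" if TT: "T \<in> B m" "T' \<in> B m" for T T'
      proof -
        have "(\<Sum>T'\<in>B m. formal_scale (c (m, T, T')) (polytabloid m T')) = 0"
        proof (rule poly_mapping_eqI)
          fix u
          show "Poly_Mapping.lookup (\<Sum>T'\<in>B m. formal_scale (c (m, T, T')) (polytabloid m T')) u = Poly_Mapping.lookup 0 u"
          proof (cases "\<exists>S. tableau m S \<and> u = tabloid m S")
            case True
            thus ?thesis using key[OF TT(1)] by (auto simp: lookup_sum)
          next
            case False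
            have "Poly_Mapping.lookup (polytabloid m T') u = 0" if T': "T' \<in> B m" for T'
              unfolding lookup_polytabloid act_tabloid
            proof (intro sum.neutral ballI)
              fix p assume p: "p \<in> column_stabilizer m T'"
              have "tableau m (p \<circ> T')" using tableau_comp[OF B(2)[OF T'] column_stabilizer_permutes[OF p]] .
              hence "tabloid m (p \<circ> T') \<noteq> u" using False by blast
              thus "(if tabloid m (p \<circ> T') = u then of_int (sign p) else 0) = (0::complex)" by simp
            qed
            thus ?thesis by (simp add: lookup_sum)
          qed
        qed
        from B(4)[OF this TT(2)] show ?thesis .
      qed
      with m show False by (auto simp: P_def)
    qed
  qed
  also have "card ?S \<le> fact n"
    using card_image_le[OF fG, of "\<lambda>h. Poly_Mapping.single h (1::complex)"] card_permutations[of "{1..n}" n] by simp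
  also have "card I = (\<Sum>l\<in>partitions n. (specht_dim l)\<^sup>2)"
    unfolding I_def using finite_partitions B(1,3) by (simp add: card_cartesian_product power2_eq_square)
  finally show ?thesis .
qed

section \<open>Lower bound for the dimensions of Specht modules\<close>

text \<open>Reading the rows of the entries as the digits of a number, with the largest entry as the leading
  digit, orders tabloids lexicographically.\<close>

definition tabloid_weight :: "nat list \<Rightarrow> (nat \<times> nat \<Rightarrow> nat) \<Rightarrow> nat" where
  "tabloid_weight l T = (\<Sum>a\<in>{1..sum_list l}. row_of l T a * Suc (length l) ^ a)"

lemma sum_digits_less:
  fixes f :: "nat \<Rightarrow> nat"
  assumes "\<And>a. a < m \<Longrightarrow> f a < b"
  shows "(\<Sum>a<m. f a * b ^ a) < b ^ m"
  using assms
proof (induction m)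
  case (Suc m)
  hence "(\<Sum>a<m. f a * b ^ a) < b ^ m" by simp
  moreover have "Suc (f m) * b ^ m \<le> b * b ^ m" using Suc.prems[of m] by (intro mult_right_mono) auto
  ultimately show ?case by simp
qed simp

lemma digits_less:
  fixes f g :: "nat \<Rightarrow> nat"
  assumes m: "m \<in> {1..n}" "f m < g m" and above: "\<And>a. a \<in> {1..n} \<Longrightarrow> m < a \<Longrightarrow> f a = g a"
    and b: "\<And>a. a \<in> {1..n} \<Longrightarrow> f a < b"
  shows "(\<Sum>a\<in>{1..n}. f a * b ^ a) < (\<Sum>a\<in>{1..n}. g a * b ^ a)"
proof -
  have split: "(\<Sum>a\<in>{1..n}. h a) = (\<Sum>a\<in>{1..<m}. h a) + h m + (\<Sum>a\<in>{m<..n}. h a)" for h :: "nat \<Rightarrow> nat"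
  proof -
    have "{1..n} = insert m ({1..<m} \<union> {m<..n})" using m by auto
    moreover have "(\<Sum>a\<in>{1..<m} \<union> {m<..n}. h a) = (\<Sum>a\<in>{1..<m}. h a) + (\<Sum>a\<in>{m<..n}. h a)"
      by (rule sum.union_disjoint) auto
    ultimately show ?thesis by simp
  qed
  \<comment> \<open>Nothing is known about \<open>f 0\<close>, which is not a digit here.\<close>
  have "(\<Sum>a\<in>{1..<m}. f a * b ^ a) = (\<Sum>a\<in>{1..<m}. (if a = 0 then 0 else f a) * b ^ a)"
    by (rule sum.cong) auto
  also have "\<dots> \<le> (\<Sum>a<m. (if a = 0 then 0 else f a) * b ^ a)"
    by (rule sum_mono2) auto
  also have "\<dots> < b ^ m" using b m by (intro sum_digits_less) (auto intro: le_less_trans[OF _ b[OF m(1)]])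
  finally have "(\<Sum>a\<in>{1..<m}. f a * b ^ a) + f m * b ^ m < Suc (f m) * b ^ m" by simp
  also have "\<dots> \<le> g m * b ^ m" using m(2) by (intro mult_right_mono) auto
  finally have "(\<Sum>a\<in>{1..<m}. f a * b ^ a) + f m * b ^ m < g m * b ^ m" .
  moreover have "(\<Sum>a\<in>{m<..n}. f a * b ^ a) = (\<Sum>a\<in>{m<..n}. g a * b ^ a)"
    using above m by (intro sum.cong) auto
  ultimately show ?thesis unfolding split by linarith
qed

text \<open>The largest entry that a column permutation moves to another row has larger entries of its column
  fixed below it, so it can only move up, where the row index is smaller. Hence the tabloid of a
  column increasing \<open>T\<close> is the leading term of its polytabloid.\<close>

lemma tabloid_weight_less:
  assumes T: "tableau l T" and inc: "\<And>i i' j. i < i' \<Longrightarrow> (i', j) \<in> diagram l \<Longrightarrow> T (i, j) < T (i', j)"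
    and p: "p \<in> column_stabilizer l T" and ne: "tabloid l (p \<circ> T) \<noteq> tabloid l T"
  shows "tabloid_weight l (p \<circ> T) < tabloid_weight l T"
proof -
  let ?N = "{1..sum_list l}"
  note P = column_stabilizer_permutes[OF p]
  note pT = tableau_comp[OF T P]
  have cp: "col_of l T (p a) = col_of l T a" if "a \<in> ?N" for a
    using p that column_stabilizer_iff[OF T] by blast
  define A where "A = {a\<in>?N. row_of l (p \<circ> T) a \<noteq> row_of l T a}"
  have "A \<noteq> {}" using ne unfolding tabloid_eq_iff[OF pT T] A_def by blast
  define m where "m = Max A"
  have fA: "finite A" by (simp add: A_def)
  have "m \<in> A" unfolding m_def using fA \<open>A \<noteq> {}\<close> by (rule Max_in)
  have above: "row_of l (p \<circ> T) a = row_of l T a" if a: "a \<in> ?N" "m < a" for a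
  proof (rule ccontr)
    assume "row_of l (p \<circ> T) a \<noteq> row_of l T a"
    hence "a \<in> A" using a unfolding A_def by blast
    from Max_ge[OF fA this] show False using a(2) by (simp add: m_def)
  qed
  have mN: "m \<in> ?N" and mr: "row_of l (p \<circ> T) m \<noteq> row_of l T m" using \<open>m \<in> A\<close> by (auto simp: A_def)
  have pre: "\<exists>b\<in>?N. p b = a \<and> row_of l (p \<circ> T) a = row_of l T b \<and> col_of l T b = col_of l T a" if a: "a \<in> ?N" for a
  proof -
    have "a \<in> p ` ?N" using a unfolding permutes_image[OF P] .
    then obtain b where b: "a = p b" "b \<in> ?N" by (rule imageE)
    show ?thesis unfolding b(1)
      by (rule bexI[OF _ b(2)]) (simp add: row_col_comp(1)[OF T P b(2)] cp[OF b(2)] del: o_apply)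
  qed
  obtain b where b: "b \<in> ?N" "p b = m" "row_of l (p \<circ> T) m = row_of l T b" "col_of l T b = col_of l T m"
    using pre[OF mN] by blast
  have "b \<noteq> m" using b mr by auto
  have "b < m"
  proof (rule ccontr)
    assume "\<not> b < m"
    hence "m < b" using \<open>b \<noteq> m\<close> by simp
    obtain d where d: "d \<in> ?N" "p d = b" "row_of l (p \<circ> T) b = row_of l T d" "col_of l T d = col_of l T b"
      using pre[OF b(1)] by blast
    have "row_of l T d = row_of l T b" using d(3) above[OF b(1) \<open>m < b\<close>] by simp
    hence "d = b" using row_col_inj[OF T d(1) b(1)] d(4) by blast
    thus False using d(2) b(2) \<open>b \<noteq> m\<close> by simp
  qed
  have "row_of l T b < row_of l T m"
  proof (rule ccontr)
    assume *: "\<not> row_of l T b < row_of l T m"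
    obtain c where c: "c \<in> diagram l" "b = T c" "row_of l T b = fst c" "col_of l T b = snd c"
      using tableau_cell[OF T b(1)] .
    obtain d where d: "d \<in> diagram l" "m = T d" "row_of l T m = fst d" "col_of l T m = snd d"
      using tableau_cell[OF T mN] .
    have "snd c = snd d" using b(4) c d by simp
    moreover have "fst c \<noteq> fst d" using \<open>b \<noteq> m\<close> c d \<open>snd c = snd d\<close> by (metis prod_eq_iff)
    ultimately have "T d < T c" using inc[of "fst d" "fst c" "snd c"] * c d by (cases c; cases d) auto
    thus False using c d \<open>b < m\<close> by simp
  qed
  hence "row_of l (p \<circ> T) m < row_of l T m" using b by simp
  thus ?thesis unfolding tabloid_weight_def
    using mN above row_less[OF pT] by (intro digits_less[of m]) (auto intro: less_SucI)
qed

lemma strict_mono_on_eq_of_image_eq: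
  fixes f g :: "nat \<Rightarrow> nat"
  assumes f: "strict_mono_on {..<k} f" and g: "strict_mono_on {..<k} g"
    and eq: "f ` {..<k} = g ` {..<k}" and j: "j < k"
  shows "f j = g j"
proof -
  have sd: "sorted (map h [0..<k]) \<and> distinct (map h [0..<k])" if "strict_mono_on {..<k} h" for h :: "nat \<Rightarrow> nat"
  proof
    show "sorted (map h [0..<k])"
      by (auto simp: sorted_iff_nth_mono_less intro!: less_imp_le strict_mono_onD[OF that])
    have "inj_on h {..<k}" using that by (rule strict_mono_on_imp_inj_on)
    thus "distinct (map h [0..<k])" by (simp add: distinct_map atLeast0LessThan)
  qed
  have "map f [0..<k] = map g [0..<k]"
    using sd[OF f] sd[OF g] eq by (intro sorted_distinct_set_unique) (auto simp: atLeast0LessThan)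
  thus ?thesis using j by simp
qed

text \<open>The rows of a standard tableau are increasing, so their sets of entries determine them.\<close>

lemma standard_tableau_tabloid_inj:
  assumes l: "l \<in> partitions n" and T: "T \<in> standard_tableaux n (nth_part l)" and S: "S \<in> standard_tableaux n (nth_part l)"
    and eq: "tabloid l T = tabloid l S"
  shows "T = S"
proof
  note y = nth_part_in_young[OF l]
  have sl: "sum_list l = n" using l by (simp add: partitions_def)
  have row: "strict_mono_on {..<nth_part l i} (\<lambda>j. U (i, j)) \<and> (\<lambda>j. U (i, j)) ` {..<nth_part l i} = tabloid l U ! i"
    if U: "U \<in> standard_tableaux n (nth_part l)" and i: "i < length l" for U i
  proof
    show "strict_mono_on {..<nth_part l i} (\<lambda>j. U (i, j))"
      by (rule strict_mono_onI) (use standard_tableau_increasing(2)[OF y U] in \<open>auto simp: cells_def\<close>)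
    show "(\<lambda>j. U (i, j)) ` {..<nth_part l i} = tabloid l U ! i"
      using i by (auto simp: tabloid_def nth_part_def)
  qed
  fix c show "T c = S c"
  proof (cases "c \<in> cells (nth_part l)")
    case False
    thus ?thesis using standard_tableau_outside[OF y T] standard_tableau_outside[OF y S] by simp
  next
    case True
    obtain i j where c: "c = (i, j)" by (cases c)
    have j: "j < nth_part l i" using True by (simp add: c cells_def)
    hence i: "i < length l" by (auto simp: nth_part_def split: if_splits)
    show ?thesis unfolding c
      using strict_mono_on_eq_of_image_eq[of "nth_part l i" "\<lambda>j. T (i, j)" "\<lambda>j. S (i, j)" j] row[OF T i] row[OF S i] eq j
      by simp
  qed
qed

lemma standard_tableau_tableau: "l \<in> partitions n \<Longrightarrow> T \<in> standard_tableaux n (nth_part l) \<Longrightarrow> tableau l T"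
  using standard_tableau_bij[OF nth_part_in_young, of l n T] unfolding tableau_def diagram_eq_cells
  by (simp add: partitions_def)

text \<open>Standard polytabloids are linearly independent because they have distinct leading tabloids: in a
  relation, look at the coefficient of the heaviest leading tabloid.\<close>

lemma paths_le_specht_dim:
  assumes l: "l \<in> partitions n"
  shows "paths n (nth_part l) \<le> specht_dim l"
proof -
  note y = nth_part_in_young[OF l]
  obtain B where "specht_basis l B" using specht_basis_exists by (rule exE)
  hence B: "finite B" "card B = specht_dim l" "formal.span (polytabloid l ` B) = specht_module l"
    by (simp_all add: specht_basis_def)
  have "card (standard_tableaux n (nth_part l)) \<le> card (polytabloid l ` B)"
  proof (rule card_le_of_independent_family[of _ _ "polytabloid l"])
    show "finite (standard_tableaux n (nth_part l))" using card_standard_tableaux[OF y] by simp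
    show "finite (polytabloid l ` B)" using B by simp
    show "polytabloid l T \<in> formal.span (polytabloid l ` B)" if "T \<in> standard_tableaux n (nth_part l)" for T
      unfolding B(3) specht_module_def using standard_tableau_tableau[OF l that] by (intro formal.span_base) blast
  next
    fix c T0 assume zero: "(\<Sum>T\<in>standard_tableaux n (nth_part l). formal_scale (c T) (polytabloid l T)) = 0"
      and T0: "T0 \<in> standard_tableaux n (nth_part l)"
    show "c T0 = 0"
    proof (rule ccontr)
      assume "c T0 \<noteq> 0"
      define A where "A = {T\<in>standard_tableaux n (nth_part l). c T \<noteq> 0}"
      have fA: "finite A" using card_standard_tableaux[OF y] by (simp add: A_def)
      have "A \<noteq> {}" using T0 \<open>c T0 \<noteq> 0\<close> by (auto simp: A_def)
      hence "Max (tabloid_weight l ` A) \<in> tabloid_weight l ` A" using fA by (intro Max_in) auto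
      then obtain T where w: "Max (tabloid_weight l ` A) = tabloid_weight l T" and T: "T \<in> A" by (rule imageE)
      have mx: "tabloid_weight l S \<le> tabloid_weight l T" if "S \<in> A" for S
        unfolding w[symmetric] using fA that by (intro Max_ge) auto
      have Ts: "T \<in> standard_tableaux n (nth_part l)" using T by (simp add: A_def)
      note tT = standard_tableau_tableau[OF l Ts]
      \<comment> \<open>The identity is the only column permutation that contributes.\<close>
      have coeff: "Poly_Mapping.lookup (polytabloid l T) (tabloid l T) = 1"
      proof -
        have id: "id \<in> column_stabilizer l T" by (simp add: column_stabilizer_def permutes_id)
        have "Poly_Mapping.lookup (polytabloid l T) (tabloid l T) =
          (\<Sum>p\<in>column_stabilizer l T. if p = id then of_int (sign p) else 0)"
          unfolding lookup_polytabloid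
          by (rule sum.cong) (use column_stabilizer_tabloid_inj[OF tT _ id] in auto)
        thus ?thesis using id by (simp add: finite_column_stabilizer)
      qed
      have others: "c S * Poly_Mapping.lookup (polytabloid l S) (tabloid l T) = 0"
        if S: "S \<in> standard_tableaux n (nth_part l)" "S \<noteq> T" for S
      proof (rule ccontr)
        assume *: "c S * Poly_Mapping.lookup (polytabloid l S) (tabloid l T) \<noteq> 0"
        hence SA: "S \<in> A" using S by (simp add: A_def)
        note tS = standard_tableau_tableau[OF l S(1)]
        have "\<exists>p\<in>column_stabilizer l S. map ((`) p) (tabloid l S) = tabloid l T"
        proof (rule ccontr)
          assume "\<not> ?thesis"
          hence "Poly_Mapping.lookup (polytabloid l S) (tabloid l T) = 0"
            unfolding lookup_polytabloid by (intro sum.neutral) auto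
          with * show False by simp
        qed
        then obtain p where p: "p \<in> column_stabilizer l S" and pS: "tabloid l (p \<circ> S) = tabloid l T"
          by (auto simp: act_tabloid)
        note tpS = tableau_comp[OF tS column_stabilizer_permutes[OF p]]
        have "tabloid l (p \<circ> S) \<noteq> tabloid l S"
          using pS standard_tableau_tabloid_inj[OF l Ts S(1)] S(2) by metis
        hence "tabloid_weight l (p \<circ> S) < tabloid_weight l S"
          using standard_tableau_increasing(1)[OF y S(1)] by (intro tabloid_weight_less[OF tS _ p]) (auto simp: diagram_eq_cells)
        moreover have "tabloid_weight l (p \<circ> S) = tabloid_weight l T"
          unfolding tabloid_weight_def using pS tabloid_eq_iff[OF tpS tT] by (intro sum.cong) auto
        ultimately show False using mx[OF SA] by simp
      qed
      have "0 = Poly_Mapping.lookup (\<Sum>T\<in>standard_tableaux n (nth_part l). formal_scale (c T) (polytabloid l T)) (tabloid l T)"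
        by (simp add: zero)
      also have "\<dots> = (\<Sum>S\<in>standard_tableaux n (nth_part l). c S * Poly_Mapping.lookup (polytabloid l S) (tabloid l T))"
        by (simp add: lookup_sum)
      also have "\<dots> = c T"
        using sum.remove[of "standard_tableaux n (nth_part l)" T "\<lambda>S. c S * Poly_Mapping.lookup (polytabloid l S) (tabloid l T)"]
          card_standard_tableaux[OF y] Ts others coeff by simp
      finally show False using T by (simp add: A_def)
    qed
  qed
  also have "\<dots> \<le> specht_dim l" using card_image_le[OF B(1)] B(2) by metis
  finally show ?thesis using card_standard_tableaux[OF y] by simp
qed

text \<open>The path counts are at most the dimensions, but their squares already sum up to $n!$, which bounds
  the sum of the squares of the dimensions.\<close>

lemma specht_dim_eq_paths:
  assumes "l \<in> partitions n"
  shows "specht_dim l = paths n (nth_part l)"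
proof (rule ccontr)
  assume ne: "specht_dim l \<noteq> paths n (nth_part l)"
  have "(\<Sum>l\<in>partitions n. (paths n (nth_part l))\<^sup>2) < (\<Sum>l\<in>partitions n. (specht_dim l)\<^sup>2)"
  proof (rule sum_strict_mono_ex1)
    show "\<forall>l\<in>partitions n. (paths n (nth_part l))\<^sup>2 \<le> (specht_dim l)\<^sup>2" using paths_le_specht_dim by simp
    have "paths n (nth_part l) < specht_dim l" using paths_le_specht_dim[OF assms] ne by simp
    hence "(paths n (nth_part l))\<^sup>2 < (specht_dim l)\<^sup>2" by (intro power_strict_mono) auto
    thus "\<exists>l\<in>partitions n. (paths n (nth_part l))\<^sup>2 < (specht_dim l)\<^sup>2" using assms by blast
  qed (rule finite_partitions)
  also have "\<dots> \<le> fact n" by (rule sum_specht_dim_squared_le)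
  also have "fact n = (\<Sum>g\<in>young n. (paths n g)\<^sup>2)" by (simp add: sum_paths_squared)
  also have "\<dots> = (\<Sum>l\<in>partitions n. (paths n (nth_part l))\<^sup>2)"
    by (rule sum.reindex_bij_betw[OF bij_betw_nth_part, symmetric])
  finally show False by simp
qed

lemma sum_specht_dim_squared: "(\<Sum>l\<in>partitions n. (specht_dim l)\<^sup>2) = fact n"
  using sum.reindex_bij_betw[OF bij_betw_nth_part, of "\<lambda>g. (paths n g)\<^sup>2" n] sum_paths_squared[of n]
  by (simp add: specht_dim_eq_paths cong: sum.cong)

lemma sum_specht_dim: "(\<Sum>l\<in>partitions n. specht_dim l) = total_paths n"
  using sum.reindex_bij_betw[OF bij_betw_nth_part, of "paths n" n]
  by (simp add: specht_dim_eq_paths total_paths_def cong: sum.cong)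

section \<open>The growth of the number of partitions\<close>

text \<open>Inserting a part is injective on multisets without any care for the order of the parts.\<close>

definition partition_multisets :: "nat \<Rightarrow> nat multiset set" where
  "partition_multisets n = {M. 0 \<notin># M \<and> \<Sum>\<^sub># M = n}"

lemma bij_betw_mset_partitions: "bij_betw mset (partitions n) (partition_multisets n)"
  unfolding bij_betw_def
proof
  show "inj_on mset (partitions n)"
  proof (rule inj_onI)
    fix l m assume "l \<in> partitions n" "m \<in> partitions n" and eq: "mset l = mset m"
    hence "sorted (rev l)" "sorted (rev m)" by (auto simp: partitions_def sorted_wrt_rev)
    moreover have "mset (rev l) = mset (rev m)" using eq by simp
    ultimately have "rev l = rev m" by (metis properties_for_sort)
    thus "l = m" by simp
  qed
  show "mset ` partitions n = partition_multisets n"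
  proof (intro equalityI subsetI)
    fix M assume M: "M \<in> partition_multisets n"
    let ?l = "rev (sorted_list_of_multiset M)"
    have "mset ?l = M" by simp
    moreover have "set ?l = set_mset M" by simp
    moreover have "sorted_wrt (\<ge>) ?l" by (simp add: sorted_wrt_rev)
    moreover have "sum_list ?l = \<Sum>\<^sub># M" by (metis calculation(1) sum_mset_sum_list)
    ultimately have "?l \<in> partitions n" using M by (auto simp: partitions_def partition_multisets_def)
    thus "M \<in> mset ` partitions n" using \<open>mset ?l = M\<close> by (metis imageI)
  qed (auto simp: partitions_def partition_multisets_def sum_mset_sum_list)
qed

lemma finite_partition_multisets: "finite (partition_multisets n)"
  using bij_betw_finite[OF bij_betw_mset_partitions] finite_partitions by blast

lemma card_partition_multisets: "card (partition_multisets n) = card (partitions n)"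
  using bij_betw_same_card[OF bij_betw_mset_partitions] by metis

lemma card_partitions_mono_Suc: "card (partitions n) \<le> card (partitions (Suc n))"
proof -
  have "card (add_mset 1 ` partition_multisets n) \<le> card (partition_multisets (Suc n))"
    by (rule card_mono[OF finite_partition_multisets]) (auto simp: partition_multisets_def)
  moreover have "inj_on (add_mset 1) (partition_multisets n)" by (rule inj_onI) simp
  ultimately show ?thesis by (simp add: card_image card_partition_multisets)
qed

lemma card_partitions_mono: "m \<le> n \<Longrightarrow> card (partitions m) \<le> card (partitions n)"
  by (rule lift_Suc_mono_le[of "\<lambda>n. card (partitions n)", OF card_partitions_mono_Suc])

lemma card_partitions_0: "card (partitions 0) = 1"
  using bij_betw_same_card[OF bij_betw_nth_part, of 0] by (simp add: young_0_eq)

lemma card_partitions_pos: "1 \<le> card (partitions n)"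
  using card_partitions_mono[of 0 n] by (simp add: card_partitions_0)

text \<open>Partitions are compositions, and there are at most $2^n$ of those: a composition of $n + 1$ either
  begins with $1$ or is obtained by increasing the first part of a composition of $n$.\<close>

lemma card_partitions_le: "card (partitions n) \<le> 2 ^ n"
proof -
  define C where "C = (\<lambda>n. {l :: nat list. 0 \<notin> set l \<and> sum_list l = n})"
  have "finite (C n) \<and> card (C n) \<le> 2 ^ n"
  proof (induction n)
    case 0
    have "C 0 \<subseteq> {[]}" by (auto simp: C_def) (metis list.set_intros(1) neq_Nil_conv)
    hence "finite (C 0)" "card (C 0) \<le> card {[] :: nat list}"
      using finite_subset card_mono by (blast, intro card_mono) auto
    thus ?case by simp
  next
    case (Suc n)
    let ?f = "\<lambda>l. Suc (hd l) # tl l"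
    have sub: "C (Suc n) \<subseteq> (#) 1 ` C n \<union> ?f ` C n"
    proof
      fix l assume l: "l \<in> C (Suc n)"
      then obtain a m where am: "l = a # m" by (cases l) (auto simp: C_def)
      show "l \<in> (#) 1 ` C n \<union> ?f ` C n"
      proof (cases "a = 1")
        case True
        thus ?thesis using l am by (auto simp: C_def)
      next
        case False
        hence "(a - 1) # m \<in> C n" "l = ?f ((a - 1) # m)" using l am by (auto simp: C_def)
        thus ?thesis by blast
      qed
    qed
    have "card (C (Suc n)) \<le> card ((#) 1 ` C n \<union> ?f ` C n)"
      using Suc by (intro card_mono[OF _ sub]) auto
    also have "\<dots> \<le> card ((#) 1 ` C n) + card (?f ` C n)" by (rule card_Un_le)
    also have "\<dots> \<le> card (C n) + card (C n)" using Suc by (intro add_mono card_image_le) auto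
    finally show ?case using Suc finite_subset[OF sub] by simp
  qed
  moreover have "partitions n \<subseteq> C n" by (auto simp: partitions_def C_def)
  ultimately show ?thesis using card_mono by (meson le_trans)
qed

lemma sum_mset_eq_sum_count:
  fixes M :: "nat multiset"
  shows "finite A \<Longrightarrow> set_mset M \<subseteq> A \<Longrightarrow> \<Sum>\<^sub># M = (\<Sum>k\<in>A. k * count M k)"
proof (induction M)
  case (add x M)
  have "(\<Sum>k\<in>A. k * count (add_mset x M) k) = (\<Sum>k\<in>A. k * count M k + (if k = x then k else 0))"
    by (rule sum.cong) auto
  thus ?case using add by (simp add: sum.distrib)
qed simp

lemma card_partition_multisets_with_part:
  assumes "1 \<le> k" "k \<le> n"
  shows "card (partitions (n - k)) \<le> card {M\<in>partition_multisets n. 1 \<le> count M k}"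
proof -
  have "card (add_mset k ` partition_multisets (n - k)) \<le> card {M\<in>partition_multisets n. 1 \<le> count M k}"
    using assms by (intro card_mono[OF finite_subset[OF _ finite_partition_multisets[of n]]]) (auto simp: partition_multisets_def)
  moreover have "inj_on (add_mset k) (partition_multisets (n - k))" by (rule inj_onI) simp
  ultimately show ?thesis by (simp add: card_image card_partition_multisets)
qed

lemma card_partition_multisets_with_two_parts:
  assumes "1 \<le> k" "2 * k \<le> n"
  shows "card (partitions (n - 2 * k)) \<le> card {M\<in>partition_multisets n. 2 \<le> count M k}"
proof -
  have "card ((\<lambda>M. add_mset k (add_mset k M)) ` partition_multisets (n - 2 * k)) \<le> card {M\<in>partition_multisets n. 2 \<le> count M k}"
    using assms by (intro card_mono[OF finite_subset[OF _ finite_partition_multisets[of n]]]) (auto simp: partition_multisets_def)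
  moreover have "inj_on (\<lambda>M. add_mset k (add_mset k M)) (partition_multisets (n - 2 * k))" by (rule inj_onI) simp
  ultimately show ?thesis by (simp add: card_image card_partition_multisets)
qed

text \<open>Sum the parts of all partitions of $n$, keeping of the multiplicity of a part \<open>k\<close> only whether it
  is at least $1$ and whether it is at least $2$; the partitions concerned arise by inserting \<open>k\<close>
  once or twice. The first sum alone would give the growth rate $e^{2 \sqrt n}$ up to powers of $n$,
  which is exactly critical for the theorem. The second sum is what beats it.\<close>

lemma partitions_recurrence:
  "(\<Sum>k\<in>{1..n}. k * card (partitions (n - k))) + (\<Sum>k\<in>{1..n div 2}. k * card (partitions (n - 2 * k)))
    \<le> n * card (partitions n)"
proof -
  have ms: "set_mset M \<subseteq> {1..n}" if "M \<in> partition_multisets n" for M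
  proof
    fix k assume k: "k \<in># M"
    have "0 \<notin># M" using that by (simp add: partition_multisets_def)
    with k have "k \<noteq> 0" by metis
    moreover have "k \<le> \<Sum>\<^sub># M" using k by (metis le_add1 multi_member_split sum_mset.add_mset)
    ultimately show "k \<in> {1..n}" using that by (simp add: partition_multisets_def)
  qed
  have ind: "(\<Sum>M\<in>partition_multisets n. if P M then k else 0) = k * card {M\<in>partition_multisets n. P M}" for P and k :: nat
    using finite_partition_multisets[of n] by (simp add: sum.If_cases Int_def)
  have "(\<Sum>k\<in>{1..n}. k * card (partitions (n - k))) + (\<Sum>k\<in>{1..n div 2}. k * card (partitions (n - 2 * k)))
    \<le> (\<Sum>k\<in>{1..n}. k * card {M\<in>partition_multisets n. 1 \<le> count M k}) + (\<Sum>k\<in>{1..n div 2}. k * card {M\<in>partition_multisets n. 2 \<le> count M k})"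
    by (intro add_mono sum_mono mult_left_mono card_partition_multisets_with_part card_partition_multisets_with_two_parts) auto
  also have "\<dots> \<le> (\<Sum>k\<in>{1..n}. k * card {M\<in>partition_multisets n. 1 \<le> count M k}) + (\<Sum>k\<in>{1..n}. k * card {M\<in>partition_multisets n. 2 \<le> count M k})"
    by (intro add_left_mono sum_mono2) auto
  also have "\<dots> = (\<Sum>k\<in>{1..n}. \<Sum>M\<in>partition_multisets n. (if 1 \<le> count M k then k else 0) + (if 2 \<le> count M k then k else 0))"
    unfolding sum.distrib ind ..
  also have "\<dots> \<le> (\<Sum>k\<in>{1..n}. \<Sum>M\<in>partition_multisets n. k * count M k)"
  proof (intro sum_mono)
    fix k :: nat and M :: "nat multiset"
    consider "count M k = 0" | "count M k = 1" | "2 \<le> count M k" by linarith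
    thus "(if 1 \<le> count M k then k else 0) + (if 2 \<le> count M k then k else 0) \<le> k * count M k"
    proof cases
      case 3
      have le: "k * 2 \<le> k * count M k" using 3 by (rule mult_le_mono2)
      have "1 \<le> count M k" using 3 by linarith
      hence "(if 1 \<le> count M k then k else 0) + (if 2 \<le> count M k then k else 0) = k * 2"
        using 3 by (simp only: if_True mult_2_right)
      thus ?thesis using le by (simp only:)
    qed auto
  qed
  also have "\<dots> = (\<Sum>M\<in>partition_multisets n. \<Sum>\<^sub># M)"
    by (subst sum.swap, intro sum.cong refl sum_mset_eq_sum_count[symmetric]) (use ms in auto)
  also have "\<dots> = n * card (partitions n)" by (simp add: partition_multisets_def card_partition_multisets[symmetric])
  finally show ?thesis .
qed

text \<open>Abel summation.\<close>

lemma sum_mult_decreasing_nonneg: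
  fixes d q :: "nat \<Rightarrow> real"
  assumes D: "\<And>m. m \<le> n \<Longrightarrow> 0 \<le> (\<Sum>j\<in>{1..m}. d j)"
    and q: "\<And>j. j \<in> {1..<n} \<Longrightarrow> q (Suc j) \<le> q j" and q0: "0 \<le> q n"
  shows "0 \<le> (\<Sum>j\<in>{1..n}. d j * q j)"
proof -
  have "(\<Sum>j\<in>{1..m}. d j) * q m \<le> (\<Sum>j\<in>{1..m}. d j * q j)" if "m \<le> n" for m
    using that
  proof (induction m)
    case (Suc m)
    have "(\<Sum>j\<in>{1..m}. d j) * q (Suc m) \<le> (\<Sum>j\<in>{1..m}. d j) * q m"
      using D[of m] q[of m] Suc.prems by (cases "m = 0") (auto intro!: mult_left_mono)
    thus ?case using Suc by (simp add: algebra_simps)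
  qed simp
  from this[of n] show ?thesis using D[of n] q0 by (meson le_refl mult_nonneg_nonneg order_trans)
qed

text \<open>The recurrence has the coefficient $j + j / 2$ at $p(n - j)$ for even \<open>j\<close> and \<open>j\<close> for odd \<open>j\<close>,
  on average $5 j / 4$. Since $p$ is increasing it can be smoothed to any $a j$ with $1 < a < 5 / 4$,
  here $a = 6 / 5$, if the coefficient at $j = 1$ is given up. The surplus is the difference of the
  two coefficients.\<close>

definition surplus :: "nat \<Rightarrow> real" where
  "surplus j = real j + (if even j then real j / 2 else 0) - (if 2 \<le> j then 6 / 5 * real j else 0)"

lemma sum_surplus_nonneg: "0 \<le> (\<Sum>j\<in>{1..m}. surplus j)"
proof -
  \<comment> \<open>The surplus is negative at odd \<open>j > 1\<close>, so the partial sums up to an odd index are critical.\<close>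
  have odd: "(\<Sum>j\<in>{1..2 * e + 1}. surplus j) = (real e)\<^sup>2 / 10 - real e / 10 + 1" for e
  proof (induction e)
    case (Suc e)
    have "{1..2 * Suc e + 1} = insert (2 * e + 3) (insert (2 * e + 2) {1..2 * e + 1})" by auto
    hence "(\<Sum>j\<in>{1..2 * Suc e + 1}. surplus j) = surplus (2 * e + 3) + (surplus (2 * e + 2) + (\<Sum>j\<in>{1..2 * e + 1}. surplus j))"
      by simp
    also have "\<dots> = (real (Suc e))\<^sup>2 / 10 - real (Suc e) / 10 + 1"
      unfolding Suc by (simp add: surplus_def field_simps power2_eq_square)
    finally show ?case .
  qed (simp add: surplus_def)
  have pos: "0 \<le> (real e)\<^sup>2 / 10 - real e / 10 + 1" for e
  proof -
    have "(real e)\<^sup>2 / 10 - real e / 10 + 1 = ((real e - 1 / 2)\<^sup>2 + 39 / 4) / 10"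
      by (simp add: field_simps power2_eq_square)
    thus ?thesis by (simp only:) (intro divide_nonneg_pos add_nonneg_nonneg, auto)
  qed
  show ?thesis
  proof (cases "odd m")
    case True
    then obtain e where "m = 2 * e + 1" by (rule oddE)
    thus ?thesis using odd[of e] pos[of e] by simp
  next
    case False
    then obtain e where m: "m = 2 * e" by (auto elim: evenE)
    show ?thesis
    proof (cases e)
      case (Suc e')
      have "{1..2 * Suc e'} = insert (2 * Suc e') {1..2 * e' + 1}" by auto
      hence "(\<Sum>j\<in>{1..m}. surplus j) = surplus (2 * Suc e') + (\<Sum>j\<in>{1..2 * e' + 1}. surplus j)"
        by (simp add: m Suc)
      moreover have "0 \<le> surplus (2 * Suc e')" by (simp add: surplus_def)
      ultimately show ?thesis using odd[of e'] pos[of e'] by simp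
    qed (simp add: m)
  qed
qed

lemma partitions_recurrence_weighted:
  "6 / 5 * (\<Sum>j\<in>{2..n}. real j * real (card (partitions (n - j)))) \<le> real n * real (card (partitions n))"
proof -
  define q where "q = (\<lambda>j. real (card (partitions (n - j))))"
  have "0 \<le> (\<Sum>j\<in>{1..n}. surplus j * q j)"
    by (rule sum_mult_decreasing_nonneg, rule sum_surplus_nonneg) (auto simp: q_def intro!: card_partitions_mono)
  also have "\<dots> = (\<Sum>j\<in>{1..n}. real j * q j) + (\<Sum>j\<in>{1..n}. (if even j then real j / 2 * q j else 0))
      - (\<Sum>j\<in>{1..n}. (if 2 \<le> j then 6 / 5 * real j * q j else 0))"
    unfolding sum.distrib[symmetric] sum_subtractf[symmetric]
    by (intro sum.cong) (auto simp: surplus_def algebra_simps)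
  also have "(\<Sum>j\<in>{1..n}. (if 2 \<le> j then 6 / 5 * real j * q j else 0)) = 6 / 5 * (\<Sum>j\<in>{2..n}. real j * q j)"
    unfolding sum_distrib_left by (intro sum.mono_neutral_cong_right) auto
  also have "(\<Sum>j\<in>{1..n}. (if even j then real j / 2 * q j else 0)) = (\<Sum>k\<in>{1..n div 2}. real k * q (2 * k))"
  proof -
    have "(\<Sum>j\<in>{1..n}. (if even j then real j / 2 * q j else 0)) = (\<Sum>j\<in>{j\<in>{1..n}. even j}. real j / 2 * q j)"
      by (intro sum.mono_neutral_cong_right) auto
    also have "\<dots> = (\<Sum>k\<in>{1..n div 2}. real k * q (2 * k))"
      by (rule sum.reindex_bij_witness[of _ "\<lambda>k. 2 * k" "\<lambda>j. j div 2"]) auto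
    finally show ?thesis .
  qed
  finally have "6 / 5 * (\<Sum>j\<in>{2..n}. real j * q j) \<le> (\<Sum>j\<in>{1..n}. real j * q j) + (\<Sum>k\<in>{1..n div 2}. real k * q (2 * k))"
    by simp
  also have "\<dots> \<le> real n * real (card (partitions n))"
    using of_nat_mono[OF partitions_recurrence[of n], where 'a = real] by (simp add: q_def)
  finally show ?thesis by (simp add: q_def)
qed

text \<open>The sum is a twofold partial sum of binomial coefficients of fixed lower index.\<close>

lemma sum_mult_choose: "(\<Sum>j\<in>{1..m}. j * (m - j choose r)) = Suc m choose Suc (Suc r)"
proof -
  have "(\<Sum>i\<le>m. (m - i) * (i choose r)) = Suc m choose Suc (Suc r)"
  proof (induction m)
    case (Suc m)
    have "(\<Sum>i\<le>Suc m. (Suc m - i) * (i choose r)) = (\<Sum>i\<le>m. (m - i) * (i choose r) + (i choose r))"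
      by (auto simp: Suc_diff_le intro!: sum.cong)
    also have "\<dots> = Suc (Suc m) choose Suc (Suc r)"
      using Suc sum_choose_upper[of r m] by (simp add: sum.distrib)
    finally show ?case .
  qed simp
  moreover have "(\<Sum>j\<in>{1..m}. j * (m - j choose r)) = (\<Sum>i\<in>{..<m}. (m - i) * (i choose r))"
    by (rule sum.reindex_bij_witness[of _ "\<lambda>i. m - i" "\<lambda>j. m - j"]) auto
  moreover have "(\<Sum>i\<le>m. (m - i) * (i choose r)) = (\<Sum>i\<in>{..<m}. (m - i) * (i choose r))"
    by (simp add: lessThan_Suc_atMost[symmetric])
  ultimately show ?thesis by simp
qed

lemma sum_mult_choose_from_2:
  "Suc (Suc k) * (\<Sum>j\<in>{2..Suc m}. j * (Suc m - j choose k)) = (m + k + 3) * (m choose Suc k)"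
proof -
  let ?S = "\<Sum>j\<in>{2..Suc m}. j * (Suc m - j choose k)"
  have "{1..Suc m} = insert 1 {2..Suc m}" by auto
  hence "(\<Sum>j\<in>{1..Suc m}. j * (Suc m - j choose k)) = (m choose k) + ?S" by simp
  hence S: "?S = (m choose Suc (Suc k)) + 2 * (m choose Suc k)"
    using sum_mult_choose[where m = "Suc m" and r = k] by simp
  have "Suc (Suc k) * (m choose Suc (Suc k)) = (m - Suc k) * (m choose Suc k)"
    using binomial_absorption[of "Suc k" m] binomial_absorb_comp[of m "Suc k"] by simp
  moreover have "(m - Suc k) * (m choose Suc k) + 2 * (Suc (Suc k) * (m choose Suc k)) = (m + k + 3) * (m choose Suc k)"
  proof (cases "Suc k \<le> m")
    case True
    then obtain d where "m = Suc k + d" by (metis le_add_diff_inverse)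
    thus ?thesis by (simp add: algebra_simps)
  qed (simp add: binomial_eq_0)
  ultimately show ?thesis unfolding S by (simp add: algebra_simps)
qed

text \<open>The left hand side is the coefficient of $x^{m + k + 2}$ in
  $\frac{1}{(k + 1)!} \bigl(\frac{6}{5} \frac{x^2}{1 - x}\bigr)^{k + 1}$, a summand of
  $\exp \bigl(\frac 65 \frac{x^2}{1 - x}\bigr)$. The coefficients of that exponential satisfy the
  weighted recurrence with equality, so it bounds the generating function of partitions from below.\<close>

lemma card_partitions_ge_choose:
  "(6 / 5) ^ Suc k / fact (Suc k) * real (m choose k) \<le> real (card (partitions (m + k + 2)))"
proof (induction k arbitrary: m)
  case 0
  let ?n = "m + 2"
  have "6 / 5 * real ?n \<le> 6 / 5 * (\<Sum>j\<in>{2..?n}. real j * real (card (partitions (?n - j))))"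
    using member_le_sum[of ?n "{2..?n}" "\<lambda>j. real j * real (card (partitions (?n - j)))"]
    by (simp add: card_partitions_0)
  also have "\<dots> \<le> real ?n * real (card (partitions ?n))" by (rule partitions_recurrence_weighted)
  finally have "real ?n * (6 / 5) \<le> real ?n * real (card (partitions ?n))" by (simp only: mult.commute)
  hence "6 / 5 \<le> real (card (partitions ?n))" by (rule mult_left_le_imp_le) simp
  thus ?case by simp
next
  case (Suc k)
  let ?n = "m + k + 3" and ?a = "6 / 5 :: real"
  let ?c = "?a ^ Suc k / fact (Suc k)"
  have n: "?n = m + Suc k + 2" by simp
  have "?c * (\<Sum>j\<in>{2..Suc m}. real j * real (Suc m - j choose k)) =
    (\<Sum>j\<in>{2..Suc m}. real j * (?c * real (Suc m - j choose k)))"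
    unfolding sum_distrib_left by (intro sum.cong refl) (simp only: mult_ac)
  also have "\<dots> \<le> (\<Sum>j\<in>{2..Suc m}. real j * real (card (partitions (?n - j))))"
  proof (intro sum_mono mult_left_mono)
    fix j assume "j \<in> {2..Suc m}"
    hence n_minus_j: "Suc m - j + k + 2 = ?n - j" by auto
    show "?c * real (Suc m - j choose k) \<le> real (card (partitions (?n - j)))"
      using Suc.IH[of "Suc m - j"] unfolding n_minus_j .
  qed simp
  also have "\<dots> \<le> (\<Sum>j\<in>{2..?n}. real j * real (card (partitions (?n - j))))"
    by (rule sum_mono2) auto
  finally have "?a * (?c * (\<Sum>j\<in>{2..Suc m}. real j * real (Suc m - j choose k))) \<le>
      ?a * (\<Sum>j\<in>{2..?n}. real j * real (card (partitions (?n - j))))"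
    by (rule mult_left_mono) simp
  also have "\<dots> \<le> real ?n * real (card (partitions ?n))" by (rule partitions_recurrence_weighted)
  finally have 1: "?a * (?c * (\<Sum>j\<in>{2..Suc m}. real j * real (Suc m - j choose k))) \<le> real ?n * real (card (partitions ?n))" .
  have "real (Suc (Suc k)) * (\<Sum>j\<in>{2..Suc m}. real j * real (Suc m - j choose k)) = real ?n * real (m choose Suc k)"
    using arg_cong[OF sum_mult_choose_from_2[of k m], of real] by (simp only: of_nat_mult of_nat_sum)
  hence S: "(\<Sum>j\<in>{2..Suc m}. real j * real (Suc m - j choose k)) = real ?n * real (m choose Suc k) / real (Suc (Suc k))"
    by (simp only: eq_divide_eq) (simp add: mult.commute)
  have "a * (b / f * (N * w / K)) = N * (a * b / (K * f) * w)" for a b f N w K :: real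
    by (simp add: mult_ac)
  hence "real ?n * (?a ^ Suc (Suc k) / fact (Suc (Suc k)) * real (m choose Suc k)) \<le> real ?n * real (card (partitions ?n))"
    using 1 unfolding S fact_Suc[of "Suc k"] power_Suc[of ?a "Suc k"] by (simp only:)
  hence "?a ^ Suc (Suc k) / fact (Suc (Suc k)) * real (m choose Suc k) \<le> real (card (partitions ?n))"
    by (rule mult_left_le_imp_le) simp
  thus ?case unfolding n .
qed

lemma power_le_fact_mult_choose: "m ^ r \<le> fact r * (m + r - 1 choose r)"
proof (cases m)
  case (Suc b)
  show ?thesis unfolding Suc
  proof (induction r)
    case (Suc r)
    have "Suc b ^ Suc r \<le> (Suc b + r) * (fact r * (b + r choose r))"
      using Suc by (simp only: power_Suc) (intro mult_mono, auto)
    also have "\<dots> = fact (Suc r) * (Suc b + Suc r - 1 choose Suc r)"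
    proof -
      have "fact (Suc r) * (Suc b + Suc r - 1 choose Suc r) = fact r * (Suc r * (Suc (b + r) choose Suc r))"
        by (simp add: algebra_simps del: binomial_Suc_Suc)
      also have "\<dots> = (Suc b + r) * (fact r * (b + r choose r))"
        unfolding Suc_times_binomial by (simp only: mult_ac add_Suc)
      finally show ?thesis ..
    qed
    finally show ?case .
  qed simp
qed (cases r; simp)

text \<open>The step from $r$ to $r + 1$ is the inequality $e \le (1 + 1 / r)^{r + 1}$.\<close>

lemma fact_le_exp: "fact (Suc r) \<le> exp 1 * real (Suc r) * (real (Suc r) / exp 1) ^ Suc r"
proof (induction r)
  case (Suc r)
  let ?x = "real (Suc r)"
  have exp_bound: "exp t \<le> (x + 1) / x" if "t = 1 / (x + 1)" "0 < x" for t x :: real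
  proof -
    have "1 - t \<le> 1 / exp t" using exp_ge_add_one_self[of "- t"] by (simp add: exp_minus inverse_eq_divide)
    moreover have "1 - t = x / (x + 1)" using that by (simp add: field_simps)
    ultimately have "x * exp t \<le> x + 1" using that(2) by (simp add: pos_le_divide_eq)
    thus ?thesis using that(2) by (simp add: pos_le_divide_eq mult.commute)
  qed
  have "exp (1 / (?x + 1)) \<le> (?x + 1) / ?x" by (rule exp_bound) auto
  hence "exp (1 / (?x + 1)) ^ Suc (Suc r) \<le> ((?x + 1) / ?x) ^ Suc (Suc r)" by (rule power_mono) simp
  moreover have "exp (1 / (?x + 1)) ^ Suc (Suc r) = exp 1"
    unfolding exp_of_nat_mult[symmetric] by simp
  ultimately have e: "exp 1 * ?x ^ Suc (Suc r) \<le> (?x + 1) ^ Suc (Suc r)"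
    by (simp add: power_divide pos_le_divide_eq)
  have "fact (Suc (Suc r)) = (?x + 1) * fact (Suc r)" by (simp add: algebra_simps)
  also have "\<dots> \<le> (?x + 1) * (exp 1 * ?x * (?x / exp 1) ^ Suc r)"
    using Suc by (intro mult_left_mono) auto
  also have "\<dots> = (?x + 1) * (exp 1 * ?x ^ Suc (Suc r)) * exp 1 / exp 1 ^ Suc (Suc r)"
    by (simp add: power_divide)
  also have "\<dots> \<le> (?x + 1) * (?x + 1) ^ Suc (Suc r) * exp 1 / exp 1 ^ Suc (Suc r)"
    using e by (intro divide_right_mono mult_right_mono mult_left_mono) auto
  also have "\<dots> = exp 1 * real (Suc (Suc r)) * (real (Suc (Suc r)) / exp 1) ^ Suc (Suc r)"
    by (simp add: power_divide add.commute)
  finally show ?case .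
qed simp

text \<open>The bound \<open>card_partitions_ge_choose\<close> with \<open>k = r\<close> close to $\sqrt n$, where it is maximal up to factors
  that are harmless here, and with the factorials estimated by \<open>fact_le_exp\<close>.\<close>

lemma card_partitions_ge_exp:
  assumes "(r + 1)\<^sup>2 \<le> n" "1 \<le> r"
  shows "(6 / 5) ^ Suc r * exp (2 * real r - 2) / (real r ^ 2 * (real r + 1)) \<le> real (card (partitions n))"
proof -
  have rn: "r\<^sup>2 + r - 1 + r + 2 = (r + 1)\<^sup>2" using assms(2) by (simp add: power2_eq_square algebra_simps)
  obtain s where s: "r = Suc s" using assms(2) by (cases r) auto
  have f: "fact r \<le> exp 1 * real r * (real r / exp 1) ^ r" using fact_le_exp[of s] by (simp only: s)
  have "(r\<^sup>2) ^ r \<le> fact r * (r\<^sup>2 + r - 1 choose r)" by (rule power_le_fact_mult_choose)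
  hence "real ((r\<^sup>2) ^ r) \<le> real (fact r * (r\<^sup>2 + r - 1 choose r))" by (simp only: of_nat_le_iff)
  hence "((real r)\<^sup>2) ^ r \<le> real (r\<^sup>2 + r - 1 choose r) * fact r"
    by (simp only: of_nat_power of_nat_mult of_nat_fact mult.commute)
  hence c: "real r ^ (2 * r) / fact r \<le> real (r\<^sup>2 + r - 1 choose r)"
    unfolding power_mult by (subst pos_divide_le_eq) simp_all
  have "exp (2 * real r - 2) / real r ^ 2 = real r ^ (2 * r) / (exp 1 * real r * (real r / exp 1) ^ r)\<^sup>2"
  proof -
    have "exp (2 * real r - 2) = (exp 1 ^ r)\<^sup>2 / (exp 1)\<^sup>2"
      by (simp add: exp_diff exp_of_nat_mult[symmetric] exp_double[symmetric])
    moreover have "(exp 1 * real r * (real r / exp 1) ^ r)\<^sup>2 = (exp 1)\<^sup>2 * real r ^ 2 * real r ^ (2 * r) / (exp 1 ^ r)\<^sup>2"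
      by (simp add: power_mult_distrib power_divide power_even_eq)
    ultimately show ?thesis using assms(2) by (simp add: field_simps)
  qed
  also have "\<dots> \<le> real r ^ (2 * r) / (fact r)\<^sup>2"
    using f assms(2) by (intro divide_left_mono power_mono mult_pos_pos) auto
  finally have *: "exp (2 * real r - 2) / real r ^ 2 \<le> real r ^ (2 * r) / (fact r)\<^sup>2" .
  have "(6 / 5) ^ Suc r * exp (2 * real r - 2) / (real r ^ 2 * (real r + 1)) =
    (6 / 5) ^ Suc r / (real r + 1) * (exp (2 * real r - 2) / real r ^ 2)" by simp
  also have "\<dots> \<le> (6 / 5) ^ Suc r / (real r + 1) * (real r ^ (2 * r) / (fact r)\<^sup>2)"
    using * by (intro mult_left_mono) auto
  also have "\<dots> = (6 / 5) ^ Suc r / fact (Suc r) * (real r ^ (2 * r) / fact r)"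
    by (simp add: power2_eq_square field_simps)
  also have "\<dots> \<le> (6 / 5) ^ Suc r / fact (Suc r) * real (r\<^sup>2 + r - 1 choose r)"
    using c by (intro mult_left_mono) auto
  also have "\<dots> \<le> real (card (partitions ((r + 1)\<^sup>2)))"
    using card_partitions_ge_choose[of r "r\<^sup>2 + r - 1"] unfolding rn .
  also have "\<dots> \<le> real (card (partitions n))" using card_partitions_mono[OF assms(1)] by simp
  finally show ?thesis .
qed

text \<open>The factor $(6 / 5)^{\sqrt n}$ that is gained over $e^{2 \sqrt n}$ absorbs every power of $n$.\<close>

lemma exp_sqrt_over_partitions: "(\<lambda>n. exp (2 * sqrt (real n)) / real (card (partitions n))) \<longlonglongrightarrow> 0"
proof -
  \<comment> \<open>The bound for $p(n)$ at \<open>r\<close> requires $(r + 1)^2 \le n$.\<close>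
  define r where "r = (\<lambda>n. nat \<lfloor>sqrt (real n)\<rfloor> - 1)"
  define h where "h = (\<lambda>r::nat. exp 6 * real r ^ 2 * (real r + 1) / (6 / 5) ^ Suc r)"
  have hl: "h \<longlonglongrightarrow> 0" unfolding h_def by real_asymp
  have rl: "filterlim r at_top sequentially" unfolding r_def by real_asymp
  have lim: "(\<lambda>n. h (r n)) \<longlonglongrightarrow> 0" by (rule filterlim_compose[OF hl rl])
  have ev: "eventually (\<lambda>n. exp (2 * sqrt (real n)) / real (card (partitions n)) \<le> h (r n)) sequentially"
    using eventually_ge_at_top[of 4]
  proof eventually_elim
    fix n :: nat assume n: "4 \<le> n"
    let ?f = "nat \<lfloor>sqrt (real n)\<rfloor>" and ?p = "real (card (partitions n))"
    have "2 \<le> sqrt (real n)" using n real_le_rsqrt[of 2 "real n"] by simp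
    hence f2: "2 \<le> ?f" by linarith
    have fs: "real ?f \<le> sqrt (real n)" "sqrt (real n) < real ?f + 1" using \<open>2 \<le> sqrt (real n)\<close> by linarith+
    have rf: "r n + 1 = ?f" and r1: "1 \<le> r n" using f2 by (auto simp: r_def)
    have "(real ?f)\<^sup>2 \<le> (sqrt (real n))\<^sup>2" by (rule power_mono[OF fs(1) of_nat_0_le_iff])
    hence "real (?f\<^sup>2) \<le> real n" by (simp only: of_nat_power real_sqrt_pow2[OF of_nat_0_le_iff])
    hence "(r n + 1)\<^sup>2 \<le> n" unfolding rf by (simp only: of_nat_le_iff)
    note p = card_partitions_ge_exp[OF this r1]
    let ?r = "real (r n)"
    let ?L = "(6 / 5) ^ Suc (r n) * exp (2 * ?r - 2) / (?r ^ 2 * (?r + 1))"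
    have L: "0 < ?L" using r1 by (intro divide_pos_pos mult_pos_pos) auto
    have "sqrt (real n) \<le> ?r + 2" using fs(2) rf[symmetric] by simp
    hence "exp (2 * sqrt (real n)) / ?p \<le> exp (2 * ?r + 4) / ?L"
      using p L by (intro frac_le) auto
    also have "\<dots> = h (r n)"
    proof -
      have "exp (2 * ?r + 4) = exp 6 * exp (2 * ?r - 2)" unfolding exp_add[symmetric] by simp
      thus ?thesis unfolding h_def by simp
    qed
    finally show "exp (2 * sqrt (real n)) / ?p \<le> h (r n)" .
  qed
  show ?thesis
    by (rule tendsto_sandwich[OF _ ev tendsto_const lim]) (auto intro!: always_eventually)
qed

section \<open>The growth of the number of involutions\<close>

text \<open>The number of involutions grows like $\sqrt{n!} \, e^{\sqrt n}$ up to powers of $n$. The induction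
  step needs that $\sqrt{n!} \, e^{\sqrt n}$ is eventually a supersolution of the recurrence of the
  involution numbers. It is, since the two sides have the quotient $1 - \frac{1}{2 n} + o(1 / n)$.
  The constant takes care of the finitely many remaining \<open>n\<close>.\<close>

lemma total_paths_le: "\<exists>C. \<forall>n. real (total_paths n) \<le> C * (sqrt (fact n) * exp (sqrt (real n)))"
proof -
  have "eventually (\<lambda>n::nat. exp (sqrt (real n + 1)) / sqrt (real n + 2) +
      sqrt ((real n + 1) / (real n + 2)) * exp (sqrt (real n)) \<le> exp (sqrt (real n + 2))) sequentially"
    by real_asymp
  then obtain N where N: "\<And>n. N \<le> n \<Longrightarrow> exp (sqrt (real n + 1)) / sqrt (real n + 2) +
      sqrt ((real n + 1) / (real n + 2)) * exp (sqrt (real n)) \<le> exp (sqrt (real n + 2))"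
    by (auto simp: eventually_sequentially)
  define b where "b = (\<lambda>n. sqrt (fact n) * exp (sqrt (real n)))"
  have b: "0 < b n" for n by (simp add: b_def)
  define C where "C = (\<Sum>n\<le>Suc N. real (total_paths n) / b n)"
  have C0: "0 \<le> C" unfolding C_def using b by (intro sum_nonneg) (simp add: less_imp_le)
  have "real (total_paths n) \<le> C * b n" for n
  proof (induction n rule: less_induct)
    case (less n)
    show ?case
    proof (cases "n \<le> Suc N")
      case True
      have "real (total_paths n) / b n \<le> C"
        unfolding C_def using True b by (intro member_le_sum) (auto simp: less_imp_le)
      thus ?thesis using b[of n] by (simp add: pos_divide_le_eq)
    next
      case False
      then obtain m where m: "n = Suc (Suc m)" "N \<le> m" by (intro that[of "n - 2"]) auto
      let ?m = "real m"
      have f: "sqrt (fact n) = sqrt (?m + 2) * sqrt (fact (Suc m))" "sqrt (fact (Suc m)) = sqrt (?m + 1) * sqrt (fact m)"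
        unfolding m real_sqrt_mult[symmetric] by (simp_all add: algebra_simps)
      have "real (total_paths n) = real (total_paths (Suc m)) + (?m + 1) * real (total_paths m)"
        by (simp add: m total_paths_Suc_Suc algebra_simps)
      also have "\<dots> \<le> C * b (Suc m) + (?m + 1) * (C * b m)"
        using less[of "Suc m"] less[of m] m by (intro add_mono mult_left_mono) auto
      also have "\<dots> = C * (sqrt (fact n) * (exp (sqrt (?m + 1)) / sqrt (?m + 2) + sqrt ((?m + 1) / (?m + 2)) * exp (sqrt ?m)))"
      proof -
        have "sqrt (?m + 1) * sqrt (?m + 1) = ?m + 1" by simp
        hence "(?m + 1) * b m = sqrt (?m + 1) * sqrt (fact (Suc m)) * exp (sqrt ?m)"
          unfolding b_def f(2) by (metis (no_types, opaque_lifting) mult.assoc)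
        moreover have "b (Suc m) = sqrt (fact (Suc m)) * exp (sqrt (?m + 1))" by (simp add: b_def add.commute)
        moreover have "sqrt (?m + 2) > 0" by simp
        ultimately show ?thesis unfolding f(1) real_sqrt_divide by (simp add: field_simps)
      qed
      also have "\<dots> \<le> C * (sqrt (fact n) * exp (sqrt (?m + 2)))"
        using N[OF m(2)] C0 by (intro mult_left_mono) auto
      also have "\<dots> = C * b n" by (simp add: b_def m add.commute)
      finally show ?thesis .
    qed
  qed
  thus ?thesis unfolding b_def by blast
qed

lemma fact_ge_exp: "(real n / exp 1) ^ n \<le> fact n"
proof (induction n)
  case (Suc n)
  let ?x = "real n"
  have e: "(?x + 1) ^ n \<le> exp 1 * ?x ^ n"
  proof (cases "n = 0")
    case False
    hence "(1 + 1 / ?x) ^ n \<le> exp 1" using exp_ge_one_plus_x_over_n_power_n[of n 1] by simp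
    moreover have "(1 + 1 / ?x) ^ n = (?x + 1) ^ n / ?x ^ n"
      using False by (simp add: power_divide[symmetric] add_divide_distrib)
    ultimately show ?thesis using False by (simp add: pos_divide_le_eq)
  qed simp
  have "(real (Suc n) / exp 1) ^ Suc n = (?x + 1) * (?x + 1) ^ n / exp 1 ^ Suc n"
    by (simp add: power_divide add.commute)
  also have "\<dots> \<le> (?x + 1) * (exp 1 * ?x ^ n) / exp 1 ^ Suc n"
    using e by (intro divide_right_mono mult_left_mono) auto
  also have "\<dots> = (?x + 1) * (?x / exp 1) ^ n" by (simp add: power_divide)
  also have "\<dots> \<le> (?x + 1) * fact n" using Suc by (intro mult_left_mono) auto
  also have "\<dots> = fact (Suc n)" by (simp add: algebra_simps)
  finally show ?case .
qed simp

lemma ln_fact_ge: "1 \<le> n \<Longrightarrow> real n * (ln (real n) - 1) \<le> ln (fact n)"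
proof -
  assume n: "1 \<le> n"
  have "ln ((real n / exp 1) ^ n) \<le> ln (fact n)"
    using fact_ge_exp[of n] n by (subst ln_le_cancel_iff) auto
  moreover have "ln ((real n / exp 1) ^ n) = real n * (ln (real n) - 1)"
    using n by (simp add: ln_realpow ln_div)
  ultimately show ?thesis by simp
qed

section \<open>The dimension vector and the constant vector\<close>

lemma partitions_eventually_ge: "eventually (\<lambda>n. n \<le> card (partitions n)) sequentially"
proof -
  have "eventually (\<lambda>n. exp (2 * sqrt (real n)) / real (card (partitions n)) < 1) sequentially"
    using exp_sqrt_over_partitions by (rule order_tendstoD) simp
  moreover have "eventually (\<lambda>n::nat. real n \<le> exp (2 * sqrt (real n))) sequentially" by real_asymp
  ultimately show ?thesis
  proof eventually_elim
    case (elim n)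
    have "0 < real (card (partitions n))" using card_partitions_pos[of n] by simp
    hence "exp (2 * sqrt (real n)) < real (card (partitions n))" using elim(1) by (simp add: pos_divide_less_eq)
    hence "real n \<le> real (card (partitions n))" using elim(2) by linarith
    thus ?case by simp
  qed
qed

lemma L2_set_specht_dim: "L2_set (\<lambda>l. real (specht_dim l)) (partitions n) = sqrt (fact n)"
  unfolding L2_set_def using arg_cong[OF sum_specht_dim_squared[of n], of real] by simp

lemma L2_set_one: "L2_set (\<lambda>_. 1) (partitions n) = sqrt (real (card (partitions n)))"
  by (simp add: L2_set_def)

lemma inner_specht_dim: "inner_on (partitions n) (\<lambda>l. real (specht_dim l)) (\<lambda>_. 1) = real (total_paths n)"
  by (simp add: inner_on_def sum_specht_dim[symmetric])

text \<open>For nonnegative vectors the Euclidean norm is at most the sum of the entries.\<close>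

lemma sqrt_fact_le_total_paths: "sqrt (fact n) \<le> real (total_paths n)"
  using L2_set_le_sum[of "partitions n" "\<lambda>l. real (specht_dim l)"]
  by (simp add: L2_set_specht_dim sum_specht_dim[symmetric])

lemma total_paths_le_norms: "real (total_paths n) \<le> sqrt (fact n) * sqrt (real (card (partitions n)))"
  using L2_set_mult_ineq[of "\<lambda>l. real (specht_dim l)" "\<lambda>_. 1" "partitions n"]
  by (simp add: L2_set_specht_dim L2_set_one sum_specht_dim[symmetric])

text \<open>The cosine of the angle is at most a constant times $\sqrt{e^{2 \sqrt n} / p(n)}$.\<close>

lemma cosine_tendsto_0: "(\<lambda>n. real (total_paths n) / (sqrt (fact n) * sqrt (real (card (partitions n))))) \<longlonglongrightarrow> 0"
proof -
  obtain C where C: "\<And>n. real (total_paths n) \<le> C * (sqrt (fact n) * exp (sqrt (real n)))"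
    using total_paths_le by blast
  have "(\<lambda>n. C * sqrt (exp (2 * sqrt (real n)) / real (card (partitions n)))) \<longlonglongrightarrow> C * sqrt 0"
    by (intro tendsto_intros exp_sqrt_over_partitions)
  hence lim: "(\<lambda>n. C * sqrt (exp (2 * sqrt (real n)) / real (card (partitions n)))) \<longlonglongrightarrow> 0" by simp
  have le: "real (total_paths n) / (sqrt (fact n) * sqrt (real (card (partitions n))))
      \<le> C * sqrt (exp (2 * sqrt (real n)) / real (card (partitions n)))" for n
  proof -
    have p: "0 < real (card (partitions n))" using card_partitions_pos[of n] by simp
    have "real (total_paths n) / (sqrt (fact n) * sqrt (real (card (partitions n))))
      \<le> C * (sqrt (fact n) * exp (sqrt (real n))) / (sqrt (fact n) * sqrt (real (card (partitions n))))"
      using C p by (intro divide_right_mono) auto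
    also have "\<dots> = C * sqrt (exp (2 * sqrt (real n)) / real (card (partitions n)))"
      using p by (simp add: real_sqrt_divide exp_double real_sqrt_power)
    finally show ?thesis .
  qed
  show ?thesis
    by (rule tendsto_sandwich[OF _ always_eventually[OF allI, OF le] tendsto_const lim]) (auto intro!: always_eventually)
qed

text \<open>The numerator lies between $\frac 12 \ln n!$ and the denominator $\frac 12 (\ln n! + \ln p(n))$. As
  $p(n) \le 2^n$, the term $\ln p(n)$ is negligible against $\ln n! \sim n \ln n$.\<close>

lemma log_ratio_tendsto_1:
  "(\<lambda>n. ln (real (total_paths n)) / ln (sqrt (fact n) * sqrt (real (card (partitions n))))) \<longlonglongrightarrow> 1"
proof -
  define g where "g = (\<lambda>n::nat. (real n * (ln (real n) - 1)) / (real n * (ln (real n) - 1) + real n * ln 2))"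
  have gl: "g \<longlonglongrightarrow> 1" unfolding g_def by real_asymp
  let ?R = "\<lambda>n. ln (real (total_paths n)) / ln (sqrt (fact n) * sqrt (real (card (partitions n))))"
  have ev: "eventually (\<lambda>n. g n \<le> ?R n \<and> ?R n \<le> 1) sequentially"
    \<comment> \<open>From $n \ge 4 > e$ on, $\ln n - 1$ is positive.\<close>
    using eventually_ge_at_top[of 4]
  proof eventually_elim
    fix n :: nat assume n: "4 \<le> n"
    define A where "A = ln (fact n :: real)"
    define P where "P = ln (real (card (partitions n)))"
    define X where "X = real n * (ln (real n) - 1)"
    have p: "1 \<le> real (card (partitions n))" using card_partitions_pos[of n] by simp
    have "exp 1 \<le> (3::real)" by (rule exp_le)
    hence "exp 1 < real n" using n by linarith
    hence "ln (exp 1) < ln (real n)" using n by (subst ln_less_cancel_iff) auto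
    hence X: "0 < X" using n by (simp add: X_def)
    have XA: "X \<le> A" using ln_fact_ge[of n] n by (simp add: A_def X_def)
    have P0: "0 \<le> P" using p by (simp add: P_def)
    have "real (card (partitions n)) \<le> 2 ^ n" using of_nat_mono[OF card_partitions_le[of n], where 'a = real] by simp
    hence "P \<le> ln (2 ^ n)" unfolding P_def using p by (subst ln_le_cancel_iff) auto
    hence P: "P \<le> real n * ln 2" by (simp add: ln_realpow)
    have lnN: "ln (sqrt (fact n) * sqrt (real (card (partitions n)))) = (A + P) / 2"
      using p by (simp add: ln_mult ln_sqrt A_def P_def)
    have pos: "0 < sqrt (fact n :: real)" by simp
    have t0: "0 < real (total_paths n)" using sqrt_fact_le_total_paths[of n] pos by linarith
    have lo: "A / 2 \<le> ln (real (total_paths n))"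
    proof -
      have "ln (sqrt (fact n)) \<le> ln (real (total_paths n))"
        using sqrt_fact_le_total_paths[of n] pos t0 by (subst ln_le_cancel_iff) auto
      thus ?thesis by (simp add: ln_sqrt A_def)
    qed
    have hi: "ln (real (total_paths n)) \<le> (A + P) / 2"
      unfolding lnN[symmetric] using total_paths_le_norms[of n] t0 p by (subst ln_le_cancel_iff) auto
    have "?R n \<le> 1" unfolding lnN using hi X XA P0 by (simp add: divide_le_eq)
    moreover have "g n \<le> ?R n"
    proof -
      have "g n = X / (X + real n * ln 2)" by (simp add: g_def X_def)
      also have "\<dots> \<le> A / (A + real n * ln 2)"
      proof -
        have "Y / (Y + c) = 1 - c / (Y + c)" if "0 < Y" "0 \<le> c" for Y c :: real
          using that by (simp add: field_simps)
        moreover have "real n * ln 2 / (A + real n * ln 2) \<le> real n * ln 2 / (X + real n * ln 2)"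
          using X XA by (intro divide_left_mono mult_pos_pos add_pos_nonneg) auto
        ultimately show ?thesis using X XA by simp
      qed
      also have "\<dots> \<le> A / (A + P)" using X XA P P0 by (intro divide_left_mono mult_pos_pos) auto
      also have "\<dots> = (A / 2) / ((A + P) / 2)" by simp
      also have "\<dots> \<le> ?R n" unfolding lnN using lo X XA P0 by (intro divide_right_mono) auto
      finally show ?thesis .
    qed
    ultimately show "g n \<le> ?R n \<and> ?R n \<le> 1" by simp
  qed
  show ?thesis
    by (rule tendsto_sandwich[OF _ _ gl tendsto_const]) (use ev in \<open>auto elim: eventually_mono\<close>)
qed

theorem theorem9p1:
  shows "((\<forall>n. finite (partitions n)) \<and>
          filterlim (\<lambda>n. card (partitions n)) at_top sequentially) \<and>
         asymptotically_log_constant partitions (\<lambda>n l. real (specht_dim l)) \<and>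
         ((\<lambda>n. angle_on (partitions n) (\<lambda>l. real (specht_dim l)) (\<lambda>_. 1)) \<longlonglongrightarrow> pi / 2) \<and>
         \<not> asymptotically_constant partitions (\<lambda>n l. real (specht_dim l))"
proof (intro conjI allI)
  show "finite (partitions n)" for n by (rule finite_partitions)
  show "filterlim (\<lambda>n. card (partitions n)) at_top sequentially"
    using filterlim_ident partitions_eventually_ge by (rule filterlim_at_top_mono)
  show "asymptotically_log_constant partitions (\<lambda>n l. real (specht_dim l))"
    unfolding asymptotically_log_constant_def inner_specht_dim L2_set_specht_dim L2_set_one
    by (rule log_ratio_tendsto_1)
  have "isCont arccos 0" by (rule isCont_arccos) auto
  from isCont_tendsto_compose[OF this cosine_tendsto_0]
  show "(\<lambda>n. angle_on (partitions n) (\<lambda>l. real (specht_dim l)) (\<lambda>_. 1)) \<longlonglongrightarrow> pi / 2"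
    unfolding angle_on_def inner_specht_dim L2_set_specht_dim L2_set_one by simp
  show "\<not> asymptotically_constant partitions (\<lambda>n l. real (specht_dim l))"
    unfolding asymptotically_constant_def inner_specht_dim L2_set_specht_dim L2_set_one
    using LIMSEQ_unique[OF cosine_tendsto_0] by fastforce
qed

end
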